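(* Let $0<\varepsilon<\infty$, $0<s<\infty$ and $0<\ell<\infty$. Let $V_1,V_2,\ldots$ and $W_1,W_2,\ldots$ be two independent sequences of independent standard Gaussian random variables, and define $X_0=0$, $X_t=\sum_{i=1}^t V_i+st$ and $Y_0=0$, $Y_t=X_t+\varepsilon\sum_{i=1}^t W_i$ for integers $t\ge 1$. Let $\tau_\ell=\inf\{t\ge 0: X_t\ge \ell\}$, let $\hat X_0=0$, $\hat X_t=st+\frac{1}{1+\varepsilon^2}(Y_t-st)$ for $t\geq 1$, and let $\eta^*_\ell=\inf\{t\ge 0:\hat X_t\ge \ell\}$. Then $$ \mathbb{E}|\eta^*_\ell-\tau_\ell| \leq \sqrt{\frac{2\ell\varepsilon^{2}}{\pi s^3(1+\varepsilon^2)}}+\sqrt{\frac{4\varepsilon^2}{s^2(1+\varepsilon^2)}}\left[3\left(\frac{\ell}{2\pi s^3}\right)^{1/4}+3\sqrt{\frac{3}{s}}+\sqrt{3s}+6\right]+\frac{4}{s\sqrt{1+\varepsilon^{2}}}+\frac{4}{s}+4 . $$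
   Context: Standard Gaussian means mean zero and unit variance. Time $t$ is discrete, ranging over the nonnegative integers. *)

theory Defs
  imports "HOL-Probability.Probability"
begin

text \<open>Sequences \<open>V\<^sub>1, V\<^sub>2, \<dots>\<close> are functions on \<open>nat\<close> of which only the values at indices
  \<open>\<ge> 1\<close> are used.\<close>

definition std_gaussian_seq :: "'a measure \<Rightarrow> (nat \<Rightarrow> 'a \<Rightarrow> real) \<Rightarrow> bool" where
  "std_gaussian_seq M V \<longleftrightarrow>
     prob_space.indep_vars M (\<lambda>_. borel) V {1..} \<and>
     (\<forall>i\<ge>1. distributed M lborel (V i) std_normal_density)"

text \<open>Independence of the two sequences as random elements of the product space of real
  sequences indexed by \<open>{1..}\<close>.\<close>

definition indep_seqs :: "'a measure \<Rightarrow> (nat \<Rightarrow> 'a \<Rightarrow> real) \<Rightarrow> (nat \<Rightarrow> 'a \<Rightarrow> real) \<Rightarrow> bool" where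
  "indep_seqs M V W \<longleftrightarrow>
     prob_space.indep_var M
       (\<Pi>\<^sub>M i\<in>{1..}. borel) (\<lambda>\<omega>. \<lambda>i\<in>{1..}. V i \<omega>)
       (\<Pi>\<^sub>M i\<in>{1..}. borel) (\<lambda>\<omega>. \<lambda>i\<in>{1..}. W i \<omega>)"

text \<open>The processes \<open>X\<close>, \<open>Y\<close> and the estimate of \<open>X\<close> from \<open>Y\<close>; the convention that all three
  start at \<open>0\<close> is automatic from the formulas (lemmas below).\<close>

definition walk_X :: "real \<Rightarrow> (nat \<Rightarrow> 'a \<Rightarrow> real) \<Rightarrow> nat \<Rightarrow> 'a \<Rightarrow> real" where
  "walk_X s V t \<omega> = (\<Sum>i=1..t. V i \<omega>) + s * real t"

definition obs_Y ::
    "real \<Rightarrow> real \<Rightarrow> (nat \<Rightarrow> 'a \<Rightarrow> real) \<Rightarrow> (nat \<Rightarrow> 'a \<Rightarrow> real) \<Rightarrow> nat \<Rightarrow> 'a \<Rightarrow> real" where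
  "obs_Y s \<epsilon> V W t \<omega> = walk_X s V t \<omega> + \<epsilon> * (\<Sum>i=1..t. W i \<omega>)"

definition est_X ::
    "real \<Rightarrow> real \<Rightarrow> (nat \<Rightarrow> 'a \<Rightarrow> real) \<Rightarrow> (nat \<Rightarrow> 'a \<Rightarrow> real) \<Rightarrow> nat \<Rightarrow> 'a \<Rightarrow> real" where
  "est_X s \<epsilon> V W t \<omega> = s * real t + 1 / (1 + \<epsilon>\<^sup>2) * (obs_Y s \<epsilon> V W t \<omega> - s * real t)"

lemma walk_X_0 [simp]: "walk_X s V 0 \<omega> = 0"
  by (simp add: walk_X_def)

lemma obs_Y_0 [simp]: "obs_Y s \<epsilon> V W 0 \<omega> = 0"
  by (simp add: obs_Y_def)

lemma est_X_0 [simp]: "est_X s \<epsilon> V W 0 \<omega> = 0"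
  by (simp add: est_X_def)

text \<open>First time at or above level \<open>l\<close>; it is \<open>\<infinity>\<close> if the level is never reached.\<close>

definition hitting_time :: "(nat \<Rightarrow> 'a \<Rightarrow> real) \<Rightarrow> real \<Rightarrow> 'a \<Rightarrow> enat" where
  "hitting_time X l \<omega> = (INF t\<in>{t. X t \<omega> \<ge> l}. enat t)"

text \<open>Distance of two possibly infinite times. In \<^typ>\<open>ereal\<close> one has \<open>\<infinity> - \<infinity> = \<infinity>\<close>, so outcomes
  for which both times are infinite count as infinite error: a finite bound on the
  expectation is then only possible if both times are almost surely finite.\<close>

definition time_dist :: "enat \<Rightarrow> enat \<Rightarrow> ennreal" where
  "time_dist a b = e2ennreal \<bar>ereal_of_enat a - ereal_of_enat b\<bar>"

lemma time_dist_enat: "time_dist (enat m) (enat n) = ennreal \<bar>real m - real n\<bar>"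
  by (simp add: time_dist_def e2ennreal_ereal)

lemma time_dist_infinity: "time_dist \<infinity> b = \<infinity>" "time_dist a \<infinity> = \<infinity>"
  by (cases b; simp add: time_dist_def) (cases a; simp add: time_dist_def)

end

theory Submission
  imports Defs
begin

text \<open>
  Put \<open>U = (V + \<epsilon> W) / (1 + \<epsilon>\<^sup>2)\<close> and \<open>R = U - V\<close>. By rotation invariance \<open>U\<close> and \<open>R\<close> are
  independent Gaussian sequences with standard deviations \<open>v = 1 / sqrt (1 + \<epsilon>\<^sup>2)\<close> and \<open>\<epsilon> v\<close>, and the
  estimate of \<open>X\<close> is the walk with drift \<open>s\<close> driven by \<open>U\<close>. For the two hitting times one has
  \<open>\<bar>\<eta> - \<tau>\<bar> = 2 max 0 (\<tau> - \<eta>) + \<eta> - \<tau>\<close>, and each term on the right is controlled by optional stopping: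
  \<open>E \<tau> \<ge> l / s\<close>; \<open>E \<eta> \<le> (l + s + v) / s\<close>, since the mean overshoot is at most \<open>s + v\<close> by
  log-concavity; and \<open>s E (max 0 (\<tau> - \<eta>))\<close> is at most the overshoot \<open>s + 1\<close> of \<open>X\<close> plus the mean
  positive part of \<open>R\<^sub>1 + \<dots> + R\<^sub>\<eta>\<close>. As \<open>\<eta>\<close> is independent of \<open>R\<close>, the latter equals
  \<open>\<epsilon> v E (sqrt \<eta>) / sqrt (2 \<pi>)\<close>, and \<open>E (sqrt \<eta>) \<le> sqrt (E \<eta>)\<close>. All this is done for the times
  truncated at \<open>n\<close>, as sums over \<open>k < n\<close> of probabilities of the events that the level has not been reached by
  time \<open>k\<close>.
\<close>

section \<open>Independence and rotation of Gaussian pairs\<close>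

context prob_space begin

text \<open>Independence in two levels: independent blocks, each with independent members, make one
  independent family. A finite index set splits into the blocks that it meets and its members in
  each; \<open>blocks\<close> factors over the former, \<open>inner\<close> over the latter. It
  serves twice, with the sequences as blocks and with the times as blocks.\<close>

lemma indep_vars_Sigma:
  assumes blocks: "indep_vars (\<lambda>k. PiM (B k) (N k)) (\<lambda>k \<omega>. \<lambda>b\<in>B k. X k b \<omega>) K"
    and inner: "\<And>k. k \<in> K \<Longrightarrow> indep_vars (N k) (X k) (B k)"
  shows "indep_vars (\<lambda>(k, b). N k b) (\<lambda>(k, b). X k b) (Sigma K B)"
  unfolding indep_vars_def2
proof (intro conjI ballI indep_setsI)
  have rv: "random_variable (N k b) (X k b)" if "k \<in> K" "b \<in> B k" for k b
    using inner[OF that(1)] that(2) by (auto simp: indep_vars_def2)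
  fix i assume i: "i \<in> Sigma K B"
  then show "random_variable (case i of (k, b) \<Rightarrow> N k b) (case i of (k, b) \<Rightarrow> X k b)"
    using rv by auto
  show "{(case i of (k, b) \<Rightarrow> X k b) -` A \<inter> space M |A. A \<in> sets (case i of (k, b) \<Rightarrow> N k b)} \<subseteq> events"
    using i rv by (auto intro!: measurable_sets)
next
  have rv: "random_variable (N k b) (X k b)" if "k \<in> K" "b \<in> B k" for k b
    using inner[OF that(1)] that(2) by (auto simp: indep_vars_def2)
  fix E :: "_ \<Rightarrow> 'a set" and J assume J: "J \<noteq> {}" "J \<subseteq> Sigma K B" "finite J"
    and E: "\<forall>j\<in>J. E j \<in> {(case j of (k, b) \<Rightarrow> X k b) -` A \<inter> space M |A. A \<in> sets (case j of (k, b) \<Rightarrow> N k b)}"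
  have "\<forall>j\<in>J. \<exists>A. E j = (case j of (k, b) \<Rightarrow> X k b) -` A \<inter> space M \<and> A \<in> sets (case j of (k, b) \<Rightarrow> N k b)"
    using E by blast
  then obtain A where A: "\<And>j. j \<in> J \<Longrightarrow> E j = (case j of (k, b) \<Rightarrow> X k b) -` A j \<inter> space M"
    "\<And>j. j \<in> J \<Longrightarrow> A j \<in> sets (case j of (k, b) \<Rightarrow> N k b)"
    by metis
  define J1 where "J1 = fst ` J"
  define J2 where "J2 = (\<lambda>k. {b. (k, b) \<in> J})"
  have JS: "J = Sigma J1 J2" by (force simp: J1_def J2_def)
  have fin: "finite J1" "J1 \<noteq> {}" "J1 \<subseteq> K" using J by (auto simp: J1_def)
  have fin2: "finite (J2 k)" for k
    unfolding J2_def by (rule finite_subset[of _ "snd ` J"]) (use J in force)+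
  have J2: "J2 k \<noteq> {}" "J2 k \<subseteq> B k" if "k \<in> J1" for k
    using that J by (auto simp: J1_def J2_def)
  \<comment> \<open>The cylinder \<open>C k\<close> collects the constraints on the chosen
    coordinates of block \<open>k\<close>, so that their joint event is one preimage under the block
    map and \<open>blocks\<close> applies to it.\<close>
  define C where "C = (\<lambda>k. {x \<in> space (PiM (B k) (N k)). \<forall>b\<in>J2 k. x b \<in> A (k, b)})"
  have C[measurable]: "C k \<in> sets (PiM (B k) (N k))" if "k \<in> J1" for k
  proof -
    have "C k = (\<Inter>b\<in>J2 k. (\<lambda>x. x b) -` A (k, b) \<inter> space (PiM (B k) (N k)))"
      using J2[OF that] by (auto simp: C_def)
    also have "\<dots> \<in> sets (PiM (B k) (N k))"
    proof (intro sets.finite_INT fin2 J2 that)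
      fix b assume b: "b \<in> J2 k"
      with A(2)[of "(k, b)"] have "A (k, b) \<in> sets (N k b)" by (auto simp: J2_def)
      moreover have "b \<in> B k" using J2[OF that] b by auto
      ultimately show "(\<lambda>x. x b) -` A (k, b) \<inter> space (PiM (B k) (N k)) \<in> sets (PiM (B k) (N k))"
        by (intro measurable_sets[OF measurable_component_singleton])
    qed
    finally show ?thesis .
  qed
  let ?X = "\<lambda>k \<omega>. \<lambda>b\<in>B k. X k b \<omega>"
  have CE: "?X k -` C k \<inter> space M = (\<Inter>b\<in>J2 k. E (k, b))" if k: "k \<in> J1" for k
  proof -
    have "E (k, b) = X k b -` A (k, b) \<inter> space M" if "b \<in> J2 k" for b
      using A(1)[of "(k, b)"] that by (auto simp: J2_def)
    moreover have "?X k \<omega> \<in> space (PiM (B k) (N k))" if "\<omega> \<in> space M" for \<omega>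
      using rv k fin(3) that by (auto simp: space_PiM dest!: measurable_space)
    ultimately show ?thesis
      using J2[OF k] by (auto simp: C_def subset_iff)
  qed
  have "(\<Inter>j\<in>J. E j) = (\<Inter>k\<in>J1. \<Inter>b\<in>J2 k. E (k, b))"
    unfolding JS by auto
  also have "\<dots> = (\<Inter>k\<in>J1. ?X k -` C k \<inter> space M)"
    using CE by auto
  also have "prob \<dots> = (\<Prod>k\<in>J1. prob (?X k -` C k \<inter> space M))"
    by (rule indep_varsD[OF blocks]) (use fin C in auto)
  also have "\<dots> = (\<Prod>k\<in>J1. \<Prod>b\<in>J2 k. prob (E (k, b)))"
  proof (rule prod.cong[OF refl])
    fix k assume k: "k \<in> J1"
    have E': "E (k, b) = X k b -` A (k, b) \<inter> space M" "A (k, b) \<in> sets (N k b)" if "b \<in> J2 k" for b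
      using A[of "(k, b)"] that by (auto simp: J2_def)
    have "prob (\<Inter>b\<in>J2 k. X k b -` A (k, b) \<inter> space M) = (\<Prod>b\<in>J2 k. prob (X k b -` A (k, b) \<inter> space M))"
      by (rule indep_varsD[OF inner]) (use fin k fin2 J2 E' in auto)
    then show "prob (?X k -` C k \<inter> space M) = (\<Prod>b\<in>J2 k. prob (E (k, b)))"
      using CE[OF k] E' by simp
  qed
  also have "\<dots> = (\<Prod>j\<in>J. prob (E j))"
    unfolding JS using fin fin2 by (subst prod.Sigma) auto
  finally show "prob (\<Inter>j\<in>J. E j) = (\<Prod>j\<in>J. prob (E j))" .
qed

text \<open>\<open>U\<close> is the regression of \<open>V\<close> on
  \<open>V + \<epsilon> W\<close>, and \<open>R\<close> is its error, so the two are uncorrelated.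
  Independence is read off the joint density: in the coordinates \<open>(u, r)\<close> the quadratic
  form in the exponent has no mixed term.\<close>

lemma indep_var_normal_rotation:
  fixes \<epsilon> :: real and V W :: "'a \<Rightarrow> real"
  assumes e: "0 < \<epsilon>" and ind: "indep_var borel V borel W"
    and V: "distributed M lborel V std_normal_density"
    and W: "distributed M lborel W std_normal_density"
  defines "U \<equiv> \<lambda>\<omega>. (V \<omega> + \<epsilon> * W \<omega>) / (1 + \<epsilon>\<^sup>2)"
  defines "R \<equiv> \<lambda>\<omega>. U \<omega> - V \<omega>"
  shows "indep_var borel U borel R"
    and "distributed M lborel U (normal_density 0 (1 / sqrt (1 + \<epsilon>\<^sup>2)))"
    and "distributed M lborel R (normal_density 0 (\<epsilon> / sqrt (1 + \<epsilon>\<^sup>2)))"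
proof -
  define a where "a = 1 + \<epsilon>\<^sup>2"
  have a: "a > 0" by (simp add: a_def add_pos_nonneg)
  have rvs[measurable]: "random_variable borel V" "random_variable borel W"
    using V W by (auto simp: distributed_def)
  have rvs2[measurable]: "random_variable borel U" "random_variable borel R"
    unfolding U_def R_def by measurable
  let ?f = "normal_density 0 (1 / sqrt a)" and ?g = "normal_density 0 (\<epsilon> / sqrt a)"
  have VW: "distributed M (lborel \<Otimes>\<^sub>M lborel) (\<lambda>\<omega>. (V \<omega>, W \<omega>))
      (\<lambda>(x, y). ennreal (std_normal_density x) * ennreal (std_normal_density y))"
    by (rule distributed_joint_indep[OF _ _ V W])
       (use ind in \<open>simp_all add: indep_var_eq lborel.sigma_finite_measure_axioms\<close>)
  \<comment> \<open>Inverting the map gives \<open>v = u - r\<close> and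
    \<open>w = (u a - v) / \<epsilon>\<close>, with Jacobian determinant
    \<open>a / \<epsilon>\<close>; this is the extra factor on the left.\<close>
  have dens: "ennreal (std_normal_density (u - r)) * ennreal (std_normal_density ((u * a - (u - r)) / \<epsilon>)) * ennreal (a / \<epsilon>)
      = ennreal (?f u) * ennreal (?g r)" for u r
  proof -
    have eq: "(u - r)\<^sup>2 / 2 + ((u * a - (u - r)) / \<epsilon>)\<^sup>2 / 2 = u\<^sup>2 * a / 2 + r\<^sup>2 * a / (2 * \<epsilon>\<^sup>2)"
      using e by (simp add: a_def field_simps power2_eq_square)
    have f: "?f u = sqrt a / sqrt (2 * pi) * exp (- (u\<^sup>2 * a / 2))"
      and g: "?g r = sqrt a / (\<epsilon> * sqrt (2 * pi)) * exp (- (r\<^sup>2 * a / (2 * \<epsilon>\<^sup>2)))"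
      using e a by (simp_all add: normal_density_def real_sqrt_mult real_sqrt_divide power_divide field_simps)
    have std: "std_normal_density x = exp (- (x\<^sup>2 / 2)) / sqrt (2 * pi)" for x
      by (simp add: normal_density_def)
    have "std_normal_density (u - r) * std_normal_density ((u * a - (u - r)) / \<epsilon>) * (a / \<epsilon>)
        = a / (\<epsilon> * (sqrt (2 * pi) * sqrt (2 * pi))) * exp (- ((u - r)\<^sup>2 / 2 + ((u * a - (u - r)) / \<epsilon>)\<^sup>2 / 2))"
      unfolding std minus_add_distrib exp_add by (simp only: times_divide_eq_left times_divide_eq_right divide_divide_eq_left mult.commute mult.left_commute)
    also have "\<dots> = (sqrt a * sqrt a) / (\<epsilon> * (sqrt (2 * pi) * sqrt (2 * pi))) * exp (- (u\<^sup>2 * a / 2 + r\<^sup>2 * a / (2 * \<epsilon>\<^sup>2)))"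
      unfolding eq using a by (simp only: real_sqrt_mult_self abs_of_pos)
    also have "\<dots> = ?f u * ?g r"
      unfolding f g minus_add_distrib exp_add
      by (simp only: times_divide_eq_left times_divide_eq_right divide_divide_eq_left mult.commute mult.left_commute)
    finally have "std_normal_density (u - r) * std_normal_density ((u * a - (u - r)) / \<epsilon>) * (a / \<epsilon>) = ?f u * ?g r" .
    then show ?thesis
      using e a by (simp add: ennreal_mult[symmetric])
  qed
  \<comment> \<open>The planar change of variables is done as two affine substitutions on the line:
    \<open>w\<close> is replaced by \<open>u\<close> for fixed \<open>v\<close>, the order of
    integration is exchanged, and then \<open>v\<close> is replaced by \<open>r\<close> for fixed
    \<open>u\<close>. The marginal laws and the joint law all follow by special choices of
    \<open>h\<close>.\<close>
  have key: "(\<integral>\<^sup>+\<omega>. h (U \<omega>, R \<omega>) \<partial>M) = (\<integral>\<^sup>+u. \<integral>\<^sup>+r. ennreal (?f u) * ennreal (?g r) * h (u, r) \<partial>lborel \<partial>lborel)"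
    if h[measurable]: "h \<in> borel_measurable (lborel \<Otimes>\<^sub>M lborel)" for h :: "real \<times> real \<Rightarrow> ennreal"
  proof -
    have [measurable]: "h \<in> borel_measurable (borel \<Otimes>\<^sub>M borel)"
      using h by (simp cong: measurable_cong_sets)
    let ?\<phi> = "\<lambda>x. ennreal (std_normal_density x)"
    have "(\<integral>\<^sup>+\<omega>. h (U \<omega>, R \<omega>) \<partial>M) =
        (\<integral>\<^sup>+\<omega>. (\<lambda>(v, w). h ((v + \<epsilon> * w) / a, (v + \<epsilon> * w) / a - v)) (V \<omega>, W \<omega>) \<partial>M)"
      by (simp add: U_def R_def a_def)
    also have "\<dots> = (\<integral>\<^sup>+x. (case x of (x, y) \<Rightarrow> ?\<phi> x * ?\<phi> y) * 
        (\<lambda>(v, w). h ((v + \<epsilon> * w) / a, (v + \<epsilon> * w) / a - v)) x \<partial>(lborel \<Otimes>\<^sub>M lborel))"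
      by (rule distributed_nn_integral[OF VW, symmetric]) measurable
    also have "\<dots> = (\<integral>\<^sup>+v. \<integral>\<^sup>+w. ?\<phi> v * ?\<phi> w * h ((v + \<epsilon> * w) / a, (v + \<epsilon> * w) / a - v) \<partial>lborel \<partial>lborel)"
      by (subst lborel.nn_integral_fst[symmetric]) simp_all
    also have "\<dots> = (\<integral>\<^sup>+v. \<integral>\<^sup>+u. ennreal (a / \<epsilon>) * (?\<phi> v * ?\<phi> ((u * a - v) / \<epsilon>) * h (u, u - v)) \<partial>lborel \<partial>lborel)"
    proof (rule nn_integral_cong)
      fix v
      have eq: "- v / \<epsilon> + a / \<epsilon> * u = (u * a - v) / \<epsilon>" "(v + \<epsilon> * ((u * a - v) / \<epsilon>)) / a = u" for u
        using e a by (simp_all add: field_simps)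
      show "(\<integral>\<^sup>+w. ?\<phi> v * ?\<phi> w * h ((v + \<epsilon> * w) / a, (v + \<epsilon> * w) / a - v) \<partial>lborel) =
        (\<integral>\<^sup>+u. ennreal (a / \<epsilon>) * (?\<phi> v * ?\<phi> ((u * a - v) / \<epsilon>) * h (u, u - v)) \<partial>lborel)"
        using e a by (subst nn_integral_real_affine[where c="a / \<epsilon>" and t="- v / \<epsilon>"])
          (simp_all only: eq, simp_all add: nn_integral_cmult abs_of_pos)
    qed
    also have "\<dots> = (\<integral>\<^sup>+u. \<integral>\<^sup>+v. ennreal (a / \<epsilon>) * (?\<phi> v * ?\<phi> ((u * a - v) / \<epsilon>) * h (u, u - v)) \<partial>lborel \<partial>lborel)"
      by (rule lborel_pair.Fubini') measurable
    also have "\<dots> = (\<integral>\<^sup>+u. \<integral>\<^sup>+r. ennreal (?f u) * ennreal (?g r) * h (u, r) \<partial>lborel \<partial>lborel)"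
    proof (rule nn_integral_cong)
      fix u
      show "(\<integral>\<^sup>+v. ennreal (a / \<epsilon>) * (?\<phi> v * ?\<phi> ((u * a - v) / \<epsilon>) * h (u, u - v)) \<partial>lborel)
        = (\<integral>\<^sup>+r. ennreal (?f u) * ennreal (?g r) * h (u, r) \<partial>lborel)"
        by (subst nn_integral_real_affine[where c="-1" and t=u])
           (simp_all add: dens[symmetric] ac_simps)
    qed
    finally show ?thesis .
  qed
  have pos: "0 < 1 / sqrt a" "0 < \<epsilon> / sqrt a" using a e by auto
  have int1: "(\<integral>\<^sup>+x. ennreal (normal_density 0 \<sigma> x) \<partial>lborel) = 1" if "0 < \<sigma>" for \<sigma>
    using that prob_space.emeasure_space_1[OF prob_space_normal_density[OF that, of 0]]
    by (simp add: emeasure_density)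
  have U: "distributed M lborel U ?f"
    unfolding distributed_def
  proof (intro conjI measure_eqI)
    fix A assume "A \<in> sets (distr M lborel U)"
    then have A[measurable]: "A \<in> sets borel" by simp
    have "emeasure (distr M lborel U) A = (\<integral>\<^sup>+\<omega>. indicator A (fst (U \<omega>, R \<omega>)) \<partial>M)"
      by (subst nn_integral_indicator[symmetric], simp, subst nn_integral_distr) simp_all
    also have "\<dots> = (\<integral>\<^sup>+u. \<integral>\<^sup>+r. (ennreal (?f u) * indicator A u) * ennreal (?g r) \<partial>lborel \<partial>lborel)"
      by (subst key[of "\<lambda>x. indicator A (fst x)"]) (simp_all add: ac_simps)
    also have "\<dots> = (\<integral>\<^sup>+u. ennreal (?f u) * indicator A u \<partial>lborel)"
      by (simp add: nn_integral_cmult int1[OF pos(2)])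
    finally show "emeasure (distr M lborel U) A = emeasure (density lborel ?f) A"
      by (simp add: emeasure_density)
  qed simp_all
  have R: "distributed M lborel R ?g"
    unfolding distributed_def
  proof (intro conjI measure_eqI)
    fix A assume "A \<in> sets (distr M lborel R)"
    then have A[measurable]: "A \<in> sets borel" by simp
    have "emeasure (distr M lborel R) A = (\<integral>\<^sup>+\<omega>. indicator A (snd (U \<omega>, R \<omega>)) \<partial>M)"
      by (subst nn_integral_indicator[symmetric], simp, subst nn_integral_distr) simp_all
    also have "\<dots> = (\<integral>\<^sup>+u. \<integral>\<^sup>+r. ennreal (?f u) * (ennreal (?g r) * indicator A r) \<partial>lborel \<partial>lborel)"
      by (subst key[of "\<lambda>x. indicator A (snd x)"]) (simp_all add: ac_simps)
    also have "\<dots> = (\<integral>\<^sup>+r. ennreal (?g r) * indicator A r \<partial>lborel)"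
      by (simp add: nn_integral_cmult nn_integral_multc int1[OF pos(1)])
    finally show "emeasure (distr M lborel R) A = emeasure (density lborel ?g) A"
      by (simp add: emeasure_density)
  qed simp_all
  have "density lborel ?f \<Otimes>\<^sub>M density lborel ?g = distr M (lborel \<Otimes>\<^sub>M lborel) (\<lambda>\<omega>. (U \<omega>, R \<omega>))"
  proof -
    have "density lborel ?f \<Otimes>\<^sub>M density lborel ?g = density (lborel \<Otimes>\<^sub>M lborel) (\<lambda>(x, y). ennreal (?f x) * ennreal (?g y))"
      by (rule pair_measure_density)
         (use pos in \<open>auto intro!: lborel.sigma_finite_measure_axioms prob_space_imp_sigma_finite prob_space_normal_density\<close>)
    also have "\<dots> = distr M (lborel \<Otimes>\<^sub>M lborel) (\<lambda>\<omega>. (U \<omega>, R \<omega>))"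
    proof (rule measure_eqI)
      fix A assume "A \<in> sets (density (lborel \<Otimes>\<^sub>M lborel) (\<lambda>(x, y). ennreal (?f x) * ennreal (?g y)))"
      then have A[measurable]: "A \<in> sets (lborel \<Otimes>\<^sub>M lborel)" by simp
      have meas: "(\<lambda>x. (case x of (u, r) \<Rightarrow> ennreal (?f u) * ennreal (?g r)) * indicator A x) \<in> borel_measurable (lborel \<Otimes>\<^sub>M lborel)"
        by measurable
      have [measurable]: "(\<lambda>\<omega>. (U \<omega>, R \<omega>)) \<in> measurable M (lborel \<Otimes>\<^sub>M lborel)" by simp
      have "emeasure (distr M (lborel \<Otimes>\<^sub>M lborel) (\<lambda>\<omega>. (U \<omega>, R \<omega>))) A
          = (\<integral>\<^sup>+x. indicator A x \<partial>distr M (lborel \<Otimes>\<^sub>M lborel) (\<lambda>\<omega>. (U \<omega>, R \<omega>)))"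
        by (rule nn_integral_indicator[symmetric]) measurable
      also have "\<dots> = (\<integral>\<^sup>+\<omega>. indicator A (U \<omega>, R \<omega>) \<partial>M)"
        by (rule nn_integral_distr) measurable
      also have "\<dots> = (\<integral>\<^sup>+u. \<integral>\<^sup>+r. ennreal (?f u) * ennreal (?g r) * indicator A (u, r) \<partial>lborel \<partial>lborel)"
        by (rule key) measurable
      also have "\<dots> = (\<integral>\<^sup>+x. (case x of (u, r) \<Rightarrow> ennreal (?f u) * ennreal (?g r)) * indicator A x \<partial>(lborel \<Otimes>\<^sub>M lborel))"
        by (subst lborel.nn_integral_fst[symmetric, OF meas]) simp
      also have "\<dots> = emeasure (density (lborel \<Otimes>\<^sub>M lborel) (\<lambda>(u, r). ennreal (?f u) * ennreal (?g r))) A"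
        by (rule emeasure_density[symmetric]) measurable
      finally show "emeasure (density (lborel \<Otimes>\<^sub>M lborel) (\<lambda>(u, r). ennreal (?f u) * ennreal (?g r))) A
          = emeasure (distr M (lborel \<Otimes>\<^sub>M lborel) (\<lambda>\<omega>. (U \<omega>, R \<omega>))) A" ..
    qed simp
    finally show ?thesis .
  qed
  with U R have "indep_var lborel U lborel R"
    by (subst indep_var_distribution_eq) (simp add: distributed_def)
  then show "indep_var borel U borel R" by (simp add: indep_var_eq)
  show "distributed M lborel U (normal_density 0 (1 / sqrt (1 + \<epsilon>\<^sup>2)))"
    "distributed M lborel R (normal_density 0 (\<epsilon> / sqrt (1 + \<epsilon>\<^sup>2)))"
    using U R by (simp_all add: a_def)
qed

end

section \<open>Walks stopped at a level\<close>

text \<open>This is the event that the first time at or above \<open>l\<close> exceeds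
  \<open>k\<close>. Summing its indicator over \<open>k < n\<close> gives that time truncated at
  \<open>n\<close>, so expectations of truncated times become finite sums of probabilities.\<close>

definition below :: "real \<Rightarrow> (nat \<Rightarrow> real) \<Rightarrow> nat \<Rightarrow> bool" where
  "below l x k \<longleftrightarrow> (\<forall>j\<le>k. x j < l)"

lemma below_0 [simp]: "below l x 0 \<longleftrightarrow> x 0 < l"
  by (simp add: below_def)

lemma below_Suc: "below l x (Suc k) \<longleftrightarrow> below l x k \<and> x (Suc k) < l"
  by (auto simp: below_def le_Suc_eq)

lemma below_imp_less: "below l x k \<Longrightarrow> x k < l"
  by (simp add: below_def)

text \<open>The sum is the path stopped at its crossing time or at \<open>n\<close>, whichever is
  earlier. The overshoot sum in the last conjunct has at most one nonzero term, at the crossing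
  step. The conjuncts are proved together because the crossing step of the last one uses the
  first.\<close>

lemma stopped_sum:
  assumes "x 0 = 0" "0 < l"
  shows "(below l x n \<longrightarrow> (\<Sum>k<n. of_bool (below l x k) * (x (Suc k) - x k)) = x n)
    \<and> (\<not> below l x n \<longrightarrow> l \<le> (\<Sum>k<n. of_bool (below l x k) * (x (Suc k) - x k)))
    \<and> (\<Sum>k<n. of_bool (below l x k) * (x (Suc k) - x k)) \<le> l + (\<Sum>k<n. of_bool (below l x k) * max 0 (x (Suc k) - l))"
proof (induction n)
  case 0
  then show ?case using assms by simp
next
  case (Suc n)
  have nn: "0 \<le> (\<Sum>k<n. of_bool (below l x k) * max 0 (x (Suc k) - l))"
    by (intro sum_nonneg) auto
  show ?case
    using Suc nn by (cases "below l x n"; cases "x (Suc n) < l") (auto simp: below_Suc)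
qed

lemma stopped_sum_ge:
  assumes "x 0 = 0" "0 < l"
  shows "l - max 0 (l - x n) \<le> (\<Sum>k<n. of_bool (below l x k) * (x (Suc k) - x k))"
  using stopped_sum[where x=x and l=l and n=n, OF assms] by (cases "below l x n") auto

text \<open>Between the crossing of \<open>y\<close> and the later crossing of \<open>x\<close>, the path \<open>x\<close> climbs from its
  value at the crossing of \<open>y\<close>, where \<open>y \<ge> l\<close>, to \<open>l\<close> plus the overshoot.\<close>

lemma between_sum:
  assumes "x 0 = 0" "y 0 = 0" "0 < l"
  shows "(\<Sum>k<n. of_bool (\<not> below l y k \<and> below l x k) * (x (Suc k) - x k))
    \<le> (\<Sum>k<n. of_bool (below l x k) * max 0 (x (Suc k) - l))
      + (\<Sum>k<n. of_bool (below l y k \<and> y (Suc k) \<ge> l) * max 0 (y (Suc k) - x (Suc k)))"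
proof -
  let ?S = "\<lambda>n. \<Sum>k<n. of_bool (\<not> below l y k \<and> below l x k) * (x (Suc k) - x k)"
  let ?O = "\<lambda>n. \<Sum>k<n. of_bool (below l x k) * max 0 (x (Suc k) - l)"
  let ?D = "\<lambda>n. \<Sum>k<n. of_bool (below l y k \<and> y (Suc k) \<ge> l) * max 0 (y (Suc k) - x (Suc k))"
  \<comment> \<open>The induction needs a bound for each phase. While only \<open>y\<close> has
    crossed, the sum is at most \<open>x n - l\<close> plus the gap recorded in \<open>?D\<close>;
    this starts correctly at the crossing of \<open>y\<close>, since there \<open>x\<close> plus the
    gap is at least \<open>y\<close>, hence at least \<open>l\<close>. When \<open>x\<close>
    crosses, \<open>x - l\<close> becomes the overshoot.\<close>
  have "(below l y n \<longrightarrow> ?S n = 0) \<and> (\<not> below l y n \<and> below l x n \<longrightarrow> ?S n \<le> x n - l + ?D n)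
      \<and> ?S n \<le> ?O n + ?D n"
  proof (induction n)
    case 0
    then show ?case using assms by simp
  next
    case (Suc n)
    have O: "0 \<le> ?O n" by (intro sum_nonneg) auto
    have D: "0 \<le> ?D n" by (intro sum_nonneg) auto
    show ?case
      using Suc O D
      by (cases "below l y n"; cases "below l x n"; cases "y (Suc n) < l"; cases "x (Suc n) < l")
         (auto simp: below_Suc)
  qed
  then show ?thesis by blast
qed


section \<open>Overshoot of Gaussian walks\<close>

lemma std_normal_positive_part:
  "has_bochner_integral lborel (\<lambda>z. std_normal_density z * max 0 z) (sqrt (2 / pi) / 2)"
proof -
  have "has_bochner_integral lborel (\<lambda>z. (std_normal_density z * \<bar>z\<bar> + std_normal_density z * z) / 2) ((sqrt (2 / pi) + 0) / 2)"
    using std_normal_moment_abs_odd[of 0] std_normal_moment_odd[of 0]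
    by (intro has_bochner_integral_divide has_bochner_integral_add) simp_all
  also have "(\<lambda>z. (std_normal_density z * \<bar>z\<bar> + std_normal_density z * z) / 2) = (\<lambda>z. std_normal_density z * max 0 z)"
    by (rule ext) (simp add: max_def)
  finally show ?thesis by simp
qed

text \<open>The left side is 1 / sqrt (2 pi), which is below 1/2, and by symmetry the half line
  carries mass at least 1/2. This is the case of threshold 0 in the excess bounds below.\<close>

lemma std_normal_positive_part_le:
  "(\<integral>\<^sup>+z. ennreal (std_normal_density z * max 0 z) \<partial>lborel) \<le> (\<integral>\<^sup>+z. ennreal (std_normal_density z) * indicator {0..} z \<partial>lborel)"
    (is "?m \<le> ?H")
proof -
  have "?m = ennreal (sqrt (2 / pi) / 2)"
    using std_normal_positive_part
    by (subst nn_integral_eq_integral) (auto simp: has_bochner_integral_iff)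
  also have "\<dots> \<le> ennreal (1 / 2)"
    using pi_gt3 by (intro ennreal_leI) simp
  also have "\<dots> \<le> ?H"
  proof -
    have one: "(\<integral>\<^sup>+z. ennreal (std_normal_density z) \<partial>lborel) = 1"
      using prob_space.emeasure_space_1[OF prob_space_normal_density[of 1 0]] by (simp add: emeasure_density)
    have "?H \<le> (\<integral>\<^sup>+z. ennreal (std_normal_density z) \<partial>lborel)"
      by (intro nn_integral_mono) (auto simp: indicator_def)
    then have fin: "?H < \<top>" unfolding one by (rule le_less_trans) simp
    then obtain h where h: "?H = ennreal h" "0 \<le> h"
      by (metis ennreal_cases less_irrefl infinity_ennreal_def)
    have sym: "(\<integral>\<^sup>+z. ennreal (std_normal_density z) * indicator {..0} z \<partial>lborel) = ?H"
      by (subst nn_integral_real_affine[where c="-1" and t=0])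
         (auto simp: normal_density_def indicator_def intro!: nn_integral_cong)
    have "(1::ennreal) = (\<integral>\<^sup>+z. ennreal (std_normal_density z) \<partial>lborel)"
      using one by simp
    also have "\<dots> \<le> (\<integral>\<^sup>+z. ennreal (std_normal_density z) * indicator {0..} z + ennreal (std_normal_density z) * indicator {..0} z \<partial>lborel)"
      by (intro nn_integral_mono) (auto simp: indicator_def)
    also have "\<dots> = ?H + ?H"
      by (subst nn_integral_add) (simp_all add: sym)
    finally have "1 \<le> h + h"
      unfolding h using h(2) by (simp add: ennreal_plus[symmetric] del: ennreal_plus)
    then show ?thesis unfolding h by (intro ennreal_leI) simp
  qed
  finally show ?thesis .
qed

text \<open>After the shift \<open>z \<mapsto> b + z\<close> the density is a multiple of \<open>exp (- b z)\<close> times the standard one,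
  and \<open>(1 - z) * (exp (- b z) - exp (- b)) \<ge> 0\<close> reduces the claim to the case \<open>b = 0\<close>.\<close>

lemma std_normal_mean_excess_nonneg:
  fixes b :: real
  assumes b: "0 \<le> b"
  shows "(\<integral>\<^sup>+z. ennreal (std_normal_density z * max 0 (z - b)) \<partial>lborel)
    \<le> (\<integral>\<^sup>+z. ennreal (std_normal_density z) * indicator {b..} z \<partial>lborel)"
proof -
  let ?\<phi> = std_normal_density
  let ?m = "\<integral>\<^sup>+z. ennreal (?\<phi> z * max 0 z) \<partial>lborel"
  let ?H = "\<integral>\<^sup>+z. ennreal (?\<phi> z) * indicator {0..} z \<partial>lborel"
  let ?A = "\<integral>\<^sup>+z. ennreal (?\<phi> (b + z) * max 0 z) \<partial>lborel"
  let ?B = "\<integral>\<^sup>+z. ennreal (?\<phi> (b + z)) * indicator {0..} z \<partial>lborel"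
  define c where "c = exp (- b\<^sup>2 / 2) * exp (- b)"
  have c: "0 \<le> c" by (simp add: c_def)
  have shift: "?\<phi> (b + z) = ?\<phi> z * (exp (- b\<^sup>2 / 2) * exp (- b * z))" for z
    by (simp add: normal_density_def exp_add[symmetric] power2_eq_square field_simps)
  have alg: "p * q * ((1 - z) * (x - y)) = (p * (q * x) + q * y * (p * z)) - (p * (q * x) * z + q * y * p)" for p q x y z :: real
    by algebra
  \<comment> \<open>The inequality is arranged without differences, because subtraction in
    \<open>ennreal\<close> truncates. Integration gives \<open>?A + c ?H \<le> B + c ?m\<close> with
    \<open>B\<close> the integral \<open>?B\<close>; then \<open>?m \<le> ?H\<close> and the
    finiteness of \<open>c ?H\<close> allow cancellation.\<close>
  have pw: "?\<phi> (b + z) * max 0 z + c * (?\<phi> z * indicator {0..} z)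
      \<le> ?\<phi> (b + z) * indicator {0..} z + c * (?\<phi> z * max 0 z)" for z
  proof (cases "0 \<le> z")
    case True
    have "0 \<le> (1 - z) * (exp (- b * z) - exp (- b))"
    proof (cases "z \<le> 1")
      case True
      then have "b * z \<le> b" using b by (simp add: mult_left_le)
      then show ?thesis using True by (intro mult_nonneg_nonneg) auto
    next
      case False
      then have "b \<le> b * z" using b by (simp add: mult_le_cancel_left1)
      then show ?thesis using False by (intro mult_nonpos_nonpos) auto
    qed
    then have "0 \<le> ?\<phi> z * exp (- b\<^sup>2 / 2) * ((1 - z) * (exp (- b * z) - exp (- b)))"
      by (rule mult_nonneg_nonneg[rotated]) simp
    also have "\<dots> = (?\<phi> z * (exp (- b\<^sup>2 / 2) * exp (- b * z)) + c * (?\<phi> z * z))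
        - (?\<phi> z * (exp (- b\<^sup>2 / 2) * exp (- b * z)) * z + c * ?\<phi> z)"
      unfolding c_def by (rule alg)
    finally show ?thesis unfolding shift using True by simp
  qed simp
  have "?A + ennreal c * ?H = (\<integral>\<^sup>+z. ennreal (?\<phi> (b + z) * max 0 z + c * (?\<phi> z * indicator {0..} z)) \<partial>lborel)"
    using c by (subst nn_integral_cmult[symmetric], simp, subst nn_integral_add[symmetric])
      (auto intro!: nn_integral_cong simp: ennreal_mult indicator_def)
  also have "\<dots> \<le> (\<integral>\<^sup>+z. ennreal (?\<phi> (b + z) * indicator {0..} z + c * (?\<phi> z * max 0 z)) \<partial>lborel)"
    by (intro nn_integral_mono ennreal_leI pw)
  also have "\<dots> = ?B + ennreal c * ?m"
    using c by (subst nn_integral_cmult[symmetric], simp, subst nn_integral_add[symmetric])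
      (auto intro!: nn_integral_cong simp: ennreal_mult indicator_def)
  also have "\<dots> \<le> ?B + ennreal c * ?H"
    by (intro add_left_mono mult_left_mono std_normal_positive_part_le) simp
  finally have le: "?A + ennreal c * ?H \<le> ?B + ennreal c * ?H" .
  have "?H \<le> (\<integral>\<^sup>+z. ennreal (?\<phi> z) \<partial>lborel)"
    by (intro nn_integral_mono) (auto simp: indicator_def)
  also have "\<dots> = 1"
    using prob_space.emeasure_space_1[OF prob_space_normal_density[of 1 0]] by (simp add: emeasure_density)
  finally have "?H < \<top>" by (rule le_less_trans) simp
  then have "ennreal c * ?H \<noteq> \<top>" by (simp add: ennreal_mult_eq_top_iff)
  with le have "?A \<le> ?B"
    by (simp add: add.commute[of _ "ennreal c * ?H"] ennreal_add_left_cancel_le)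
  also have "?A = (\<integral>\<^sup>+z. ennreal (?\<phi> z * max 0 (z - b)) \<partial>lborel)"
    by (subst nn_integral_real_affine[where c=1 and t=b and f="\<lambda>z. ennreal (?\<phi> z * max 0 (z - b))"]) simp_all
  also have "?B = (\<integral>\<^sup>+z. ennreal (?\<phi> z) * indicator {b..} z \<partial>lborel)"
    by (subst nn_integral_real_affine[where c=1 and t=b and f="\<lambda>z. ennreal (?\<phi> z) * indicator {b..} z"])
       (auto intro!: nn_integral_cong simp: indicator_def)
  finally show ?thesis .
qed

text \<open>For a negative threshold \<open>b \<ge> - c\<close>, the excess over \<open>b\<close> is
  at most the positive part of \<open>z\<close> plus \<open>c\<close> on the half line from
  \<open>b\<close>. The first piece costs one copy of the tail mass, the second \<open>c\<close>
  copies.\<close>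

lemma std_normal_mean_excess:
  fixes b :: real
  assumes c: "0 \<le> c" "- c \<le> b"
  shows "(\<integral>\<^sup>+z. ennreal (std_normal_density z * max 0 (z - b)) \<partial>lborel)
    \<le> ennreal (c + 1) * (\<integral>\<^sup>+z. ennreal (std_normal_density z) * indicator {b..} z \<partial>lborel)" (is "_ \<le> _ * ?B")
proof (cases "0 \<le> b")
  case True
  have "(\<integral>\<^sup>+z. ennreal (std_normal_density z * max 0 (z - b)) \<partial>lborel) \<le> 1 * ?B"
    using std_normal_mean_excess_nonneg[OF True] by simp
  also have "\<dots> \<le> ennreal (c + 1) * ?B"
    using c by (intro mult_right_mono) auto
  finally show ?thesis .
next
  case False
  have "(\<integral>\<^sup>+z. ennreal (std_normal_density z * max 0 (z - b)) \<partial>lborel)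
      \<le> (\<integral>\<^sup>+z. ennreal (std_normal_density z * max 0 z) + ennreal c * (ennreal (std_normal_density z) * indicator {b..} z) \<partial>lborel)"
  proof (intro nn_integral_mono)
    fix z
    have "max 0 (z - b) \<le> max 0 z + c * indicator {b..} z"
      using c False by (auto simp: indicator_def)
    then have "std_normal_density z * max 0 (z - b) \<le> std_normal_density z * (max 0 z + c * indicator {b..} z)"
      by (intro mult_left_mono) auto
    then have "ennreal (std_normal_density z * max 0 (z - b)) \<le> ennreal (std_normal_density z * max 0 z + c * (std_normal_density z * indicator {b..} z))"
      by (intro ennreal_leI) (simp add: algebra_simps)
    also have "\<dots> = ennreal (std_normal_density z * max 0 z) + ennreal c * (ennreal (std_normal_density z) * indicator {b..} z)"
      using c by (auto simp: ennreal_mult indicator_def)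
    finally show "ennreal (std_normal_density z * max 0 (z - b)) \<le> \<dots>" .
  qed
  also have "\<dots> = (\<integral>\<^sup>+z. ennreal (std_normal_density z * max 0 z) \<partial>lborel) + ennreal c * ?B"
    by (subst nn_integral_add) (simp_all add: nn_integral_cmult)
  also have "\<dots> \<le> (\<integral>\<^sup>+z. ennreal (std_normal_density z) * indicator {0..} z \<partial>lborel) + ennreal c * ?B"
    by (intro add_right_mono std_normal_positive_part_le)
  also have "\<dots> \<le> ?B + ennreal c * ?B"
    using False by (intro add_right_mono nn_integral_mono) (auto simp: indicator_def)
  also have "\<dots> = ennreal (c + 1) * ?B"
    using c by (simp add: distrib_right add.commute)
  finally show ?thesis .
qed

context prob_space begin

text \<open>One step of a walk: \<open>Q\<close> is the remaining distance to the level, with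
  nonpositive values marking paths that have already crossed, and \<open>s + Z\<close> is the next
  increment. Conditioning on \<open>Q\<close> reduces the claim to the excess bound for a standard
  normal variable.\<close>

lemma normal_mean_excess:
  fixes Q Z :: "'a \<Rightarrow> real"
  assumes ind: "indep_var borel Q borel Z"
    and Z: "distributed M lborel Z (normal_density 0 v)" and v: "0 < v" and s: "0 \<le> s"
  shows "(\<integral>\<^sup>+\<omega>. ennreal (of_bool (0 < Q \<omega>) * max 0 (s + Z \<omega> - Q \<omega>)) \<partial>M)
    \<le> ennreal (s + v) * (\<integral>\<^sup>+\<omega>. ennreal (of_bool (0 < Q \<omega> \<and> Q \<omega> \<le> s + Z \<omega>)) \<partial>M)"
proof -
  have [measurable]: "Q \<in> borel_measurable M" "Z \<in> borel_measurable M"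
    using ind by (auto dest: indep_var_rv1 indep_var_rv2)
  \<comment> \<open>By independence the law of \<open>(Q, Z)\<close> is a product, and
    \<open>Z\<close> is \<open>v\<close> times a standard normal variable.\<close>
  have nn: "(\<integral>\<^sup>+\<omega>. f (Q \<omega>) (Z \<omega>) \<partial>M) = (\<integral>\<^sup>+q. \<integral>\<^sup>+z. ennreal (std_normal_density z) * f q (v * z) \<partial>lborel \<partial>distr M borel Q)"
    if f[measurable]: "case_prod f \<in> borel_measurable (borel \<Otimes>\<^sub>M borel)" for f :: "real \<Rightarrow> real \<Rightarrow> ennreal"
  proof -
    interpret Z: prob_space "distr M borel Z" by (rule prob_space_distr) simp
    have "(\<integral>\<^sup>+\<omega>. f (Q \<omega>) (Z \<omega>) \<partial>M) = (\<integral>\<^sup>+x. case_prod f x \<partial>distr M (borel \<Otimes>\<^sub>M borel) (\<lambda>\<omega>. (Q \<omega>, Z \<omega>)))"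
      by (subst nn_integral_distr) simp_all
    also have "\<dots> = (\<integral>\<^sup>+x. case_prod f x \<partial>(distr M borel Q \<Otimes>\<^sub>M distr M borel Z))"
      using ind by (simp add: indep_var_distribution_eq)
    also have "\<dots> = (\<integral>\<^sup>+q. \<integral>\<^sup>+z. f q z \<partial>distr M borel Z \<partial>distr M borel Q)"
      by (subst Z.nn_integral_fst[symmetric]) simp_all
    also have "\<dots> = (\<integral>\<^sup>+q. \<integral>\<^sup>+z. ennreal (std_normal_density z) * f q (v * z) \<partial>lborel \<partial>distr M borel Q)"
    proof (rule nn_integral_cong)
      fix q
      have dv: "v * normal_density 0 v (v * z) = std_normal_density z" for z
        using v by (simp add: normal_density_def real_sqrt_mult field_simps power2_eq_square)
      have "(\<integral>\<^sup>+z. f q z \<partial>distr M borel Z) = (\<integral>\<^sup>+\<omega>. f q (Z \<omega>) \<partial>M)"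
        by (subst nn_integral_distr) simp_all
      also have "\<dots> = (\<integral>\<^sup>+z. ennreal (normal_density 0 v z) * f q z \<partial>lborel)"
        by (rule distributed_nn_integral[OF Z, symmetric]) simp
      also have "\<dots> = ennreal v * (\<integral>\<^sup>+z. ennreal (normal_density 0 v (v * z)) * f q (v * z) \<partial>lborel)"
        using v by (subst nn_integral_real_affine[where c=v and t=0]) simp_all
      also have "\<dots> = (\<integral>\<^sup>+z. ennreal (std_normal_density z) * f q (v * z) \<partial>lborel)"
        using v by (subst nn_integral_cmult[symmetric])
          (simp_all add: mult.assoc[symmetric] ennreal_mult[symmetric] dv)
      finally show "(\<integral>\<^sup>+z. f q z \<partial>distr M borel Z) = (\<integral>\<^sup>+z. ennreal (std_normal_density z) * f q (v * z) \<partial>lborel)" .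
    qed
    finally show ?thesis .
  qed
  have "(\<integral>\<^sup>+\<omega>. ennreal (of_bool (0 < Q \<omega>) * max 0 (s + Z \<omega> - Q \<omega>)) \<partial>M)
      = (\<integral>\<^sup>+q. \<integral>\<^sup>+z. ennreal (std_normal_density z) * ennreal (of_bool (0 < q) * max 0 (s + v * z - q)) \<partial>lborel \<partial>distr M borel Q)"
    by (rule nn) simp
  also have "\<dots> \<le> (\<integral>\<^sup>+q. ennreal (s + v) * \<integral>\<^sup>+z. ennreal (std_normal_density z) * ennreal (of_bool (0 < q \<and> q \<le> s + v * z)) \<partial>lborel \<partial>distr M borel Q)"
  proof (rule nn_integral_mono)
    fix q
    show "(\<integral>\<^sup>+z. ennreal (std_normal_density z) * ennreal (of_bool (0 < q) * max 0 (s + v * z - q)) \<partial>lborel)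
      \<le> ennreal (s + v) * (\<integral>\<^sup>+z. ennreal (std_normal_density z) * ennreal (of_bool (0 < q \<and> q \<le> s + v * z)) \<partial>lborel)"
    proof (cases "0 < q")
      case True
      \<comment> \<open>Since \<open>q > 0\<close>, the threshold satisfies
        \<open>?b \<ge> - (s / v)\<close>. The excess bound with \<open>c = s / v\<close> then
        yields the constant \<open>v (s / v + 1) = s + v\<close>.\<close>
      let ?b = "(q - s) / v"
      have "max 0 (s + v * z - q) = v * max 0 (z - ?b)" for z
        using v by (simp add: max_def field_simps)
      then have "(\<integral>\<^sup>+z. ennreal (std_normal_density z) * ennreal (of_bool (0 < q) * max 0 (s + v * z - q)) \<partial>lborel)
          = (\<integral>\<^sup>+z. ennreal v * ennreal (std_normal_density z * max 0 (z - ?b)) \<partial>lborel)"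
        using v True by (simp add: ennreal_mult[symmetric] ac_simps)
      also have "\<dots> = ennreal v * (\<integral>\<^sup>+z. ennreal (std_normal_density z * max 0 (z - ?b)) \<partial>lborel)"
        by (rule nn_integral_cmult) simp
      also have "\<dots> \<le> ennreal v * (ennreal (s / v + 1) * (\<integral>\<^sup>+z. ennreal (std_normal_density z) * indicator {?b..} z \<partial>lborel))"
        using v s True by (intro mult_left_mono std_normal_mean_excess) (auto simp: field_simps)
      also have "\<dots> = ennreal (s + v) * (\<integral>\<^sup>+z. ennreal (std_normal_density z) * indicator {?b..} z \<partial>lborel)"
        using v s by (simp add: mult.assoc[symmetric] ennreal_mult[symmetric] distrib_left)
      also have "(\<integral>\<^sup>+z. ennreal (std_normal_density z) * indicator {?b..} z \<partial>lborel)
          = (\<integral>\<^sup>+z. ennreal (std_normal_density z) * ennreal (of_bool (0 < q \<and> q \<le> s + v * z)) \<partial>lborel)"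
        using v True by (intro nn_integral_cong) (auto simp: indicator_def field_simps)
      finally show ?thesis .
    qed simp
  qed
  also have "\<dots> = ennreal (s + v) * (\<integral>\<^sup>+q. \<integral>\<^sup>+z. ennreal (std_normal_density z) * ennreal (of_bool (0 < q \<and> q \<le> s + v * z)) \<partial>lborel \<partial>distr M borel Q)"
    by (rule nn_integral_cmult) simp
  also have "\<dots> = ennreal (s + v) * (\<integral>\<^sup>+\<omega>. ennreal (of_bool (0 < Q \<omega> \<and> Q \<omega> \<le> s + Z \<omega>)) \<partial>M)"
    by (subst nn) simp_all
  finally show ?thesis .
qed

end

section \<open>Expectations up to the crossing time\<close>

lemma walk_X_Suc: "walk_X s Z (Suc k) \<omega> = walk_X s Z k \<omega> + (s + Z (Suc k) \<omega>)"
  by (simp add: walk_X_def algebra_simps)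

text \<open>Writes the walk up to time \<open>k\<close> as a function of the first \<open>k\<close>
  noise variables: on path space the coordinate maps serve as the driving sequence. The map
  \<open>g\<close> extracts a real increment from a noise variable that may be a pair.\<close>

lemma walk_X_restrict:
  "j \<le> k \<Longrightarrow> walk_X s (\<lambda>i z. g (z i)) j (\<lambda>i\<in>{1..k}. Z i \<omega>) = walk_X s (\<lambda>i \<omega>. g (Z i \<omega>)) j \<omega>"
  unfolding walk_X_def by (auto intro!: sum.cong)

lemma walk_X_PiM_measurable:
  assumes [measurable]: "g \<in> measurable N borel" and "j \<le> k"
  shows "walk_X s (\<lambda>i z. g (z i)) j \<in> borel_measurable (PiM {1..k} (\<lambda>_. N))"
  unfolding walk_X_def
  using assms(2) by (intro borel_measurable_add borel_measurable_sum borel_measurable_const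
    measurable_compose[OF measurable_component_singleton[where M="\<lambda>_. N"] assms(1)]) auto

lemma below_measurable:
  assumes "\<And>j. j \<le> k \<Longrightarrow> (\<lambda>\<omega>. x \<omega> j) \<in> borel_measurable M"
  shows "Measurable.pred M (\<lambda>\<omega>. below l (x \<omega>) k)"
proof -
  have "{\<omega> \<in> space M. below l (x \<omega>) k} = (\<Inter>j\<in>{..k}. {\<omega> \<in> space M. x \<omega> j < l})"
    by (auto simp: below_def)
  also have "\<dots> \<in> sets M"
    using assms by (intro sets.finite_INT) (auto intro: borel_measurable_less)
  finally show ?thesis by (simp add: pred_def)
qed

section \<open>Independence of the past from the next increment, and the total mean
  overshoot\<close>

context prob_space begin

lemma indep_var_past_next:
  assumes Z: "indep_vars (\<lambda>_. N) Z {1..}"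
    and f: "f \<in> measurable (PiM {1..k} (\<lambda>_. N)) L" and g: "g \<in> measurable N L'"
  shows "indep_var L (\<lambda>\<omega>. f (\<lambda>i\<in>{1..k}. Z i \<omega>)) L' (\<lambda>\<omega>. g (Z (Suc k) \<omega>))"
proof -
  have ind: "indep_var (PiM {1..k} (\<lambda>_. N)) (\<lambda>\<omega>. \<lambda>i\<in>{1..k}. Z i \<omega>)
      (PiM {Suc k} (\<lambda>_. N)) (\<lambda>\<omega>. \<lambda>i\<in>{Suc k}. Z i \<omega>)"
    by (rule indep_var_restrict[OF Z]) auto
  have g': "(\<lambda>z. g (z (Suc k))) \<in> measurable (PiM {Suc k} (\<lambda>_. N)) L'"
    by (rule measurable_compose[OF measurable_component_singleton[where M="\<lambda>_. N"] g]) simp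
  show ?thesis
    using indep_var_compose[OF ind f g'] by (simp add: comp_def)
qed

lemma integrable_of_bool_mult:
  fixes f :: "'a \<Rightarrow> real"
  assumes "integrable M f" and [measurable]: "Measurable.pred M P"
  shows "integrable M (\<lambda>\<omega>. of_bool (P \<omega>) * f \<omega>)"
  using assms(1) by (rule Bochner_Integration.integrable_bound) (use assms(1) in \<open>auto simp: borel_measurable_integrable\<close>)

lemma expectation_of_bool:
  assumes [measurable]: "Measurable.pred M P"
  shows "expectation (\<lambda>\<omega>. of_bool (P \<omega>)) = prob {\<omega> \<in> space M. P \<omega>}"
proof -
  have "expectation (\<lambda>\<omega>. of_bool (P \<omega>)) = expectation (\<lambda>\<omega>. indicator {\<omega> \<in> space M. P \<omega>} \<omega>)"
    by (rule Bochner_Integration.integral_cong) (auto simp: indicator_def)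
  also have "\<dots> = prob {\<omega> \<in> space M. P \<omega>}"
    by (subst Bochner_Integration.integral_indicator) (auto intro!: arg_cong[where f=prob])
  finally show ?thesis .
qed

lemma normal_integrable:
  assumes "distributed M lborel Z (normal_density 0 v)" "0 < v"
  shows "integrable M Z" "expectation Z = 0"
  using assms distributed_integrable[OF assms(1), of "\<lambda>x. x"] integrable_normal_moment[of v 0 1]
  by (auto intro: normal_distributed_expectation)

text \<open>One summand of Wald's identity: when an event is independent of the centred noise
  \<open>Z\<close>, only the drift contributes on it.\<close>

lemma drift_expectation:
  assumes ind: "indep_var borel (\<lambda>\<omega>. of_bool (P \<omega>) :: real) borel Z" and [measurable]: "Measurable.pred M P"
    and Z: "integrable M Z" "expectation Z = 0"
  shows "integrable M (\<lambda>\<omega>. of_bool (P \<omega>) * (s + Z \<omega>))"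
    "expectation (\<lambda>\<omega>. of_bool (P \<omega>) * (s + Z \<omega>)) = s * prob {\<omega> \<in> space M. P \<omega>}"
proof -
  show "integrable M (\<lambda>\<omega>. of_bool (P \<omega>) * (s + Z \<omega>))"
    using Z by (intro integrable_of_bool_mult) auto
  have b: "integrable M (\<lambda>\<omega>. of_bool (P \<omega>) :: real)"
    using integrable_of_bool_mult[of "\<lambda>_. 1" P] by simp
  have "expectation (\<lambda>\<omega>. of_bool (P \<omega>) * (s + Z \<omega>)) = expectation (\<lambda>\<omega>. s * of_bool (P \<omega>) + of_bool (P \<omega>) * Z \<omega>)"
    by (simp add: algebra_simps)
  also have "\<dots> = s * expectation (\<lambda>\<omega>. of_bool (P \<omega>)) + expectation (\<lambda>\<omega>. of_bool (P \<omega>) * Z \<omega>)"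
    using b integrable_of_bool_mult[OF Z(1)] by simp
  also have "expectation (\<lambda>\<omega>. of_bool (P \<omega>) * Z \<omega>) = 0"
    using indep_var_lebesgue_integral[OF ind b Z(1)] Z(2) by simp
  finally show "expectation (\<lambda>\<omega>. of_bool (P \<omega>) * (s + Z \<omega>)) = s * prob {\<omega> \<in> space M. P \<omega>}"
    by (simp add: expectation_of_bool)
qed

lemma walk_X_measurable:
  assumes "indep_vars (\<lambda>_. borel) Z {1..}"
  shows "walk_X s Z k \<in> borel_measurable M"
  unfolding walk_X_def using assms
  by (intro borel_measurable_add borel_measurable_sum) (auto simp: indep_vars_def2)

lemma walk_X_integrable:
  assumes "\<And>i. 1 \<le> i \<Longrightarrow> distributed M lborel (Z i) (normal_density 0 v)" "0 < v"
  shows "integrable M (walk_X s Z k)"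
  unfolding walk_X_def using assms
  by (intro Bochner_Integration.integrable_add Bochner_Integration.integrable_sum) (auto intro: normal_integrable)

abbreviation prob_below :: "real \<Rightarrow> (nat \<Rightarrow> 'a \<Rightarrow> real) \<Rightarrow> nat \<Rightarrow> real" where
  "prob_below l X k \<equiv> prob {\<omega> \<in> space M. below l (\<lambda>j. X j \<omega>) k}"

text \<open>The right side is \<open>s + v\<close> times the probability of crossing exactly at time
  \<open>Suc k\<close>. The distance to the level at time \<open>k\<close> depends on the first
  \<open>k\<close> increments, so \<open>normal_mean_excess\<close> applies to it and the next
  one.\<close>

lemma overshoot_step:
  assumes Z: "indep_vars (\<lambda>_. borel) Z {1..}"
    and D: "\<And>i. 1 \<le> i \<Longrightarrow> distributed M lborel (Z i) (normal_density 0 v)" and v: "0 < v" and s: "0 \<le> s"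
  shows "expectation (\<lambda>\<omega>. of_bool (below l (\<lambda>j. walk_X s Z j \<omega>) k) * max 0 (walk_X s Z (Suc k) \<omega> - l))
    \<le> (s + v) * (prob_below l (walk_X s Z) k - prob_below l (walk_X s Z) (Suc k))"
proof -
  note [measurable] = walk_X_measurable[OF Z]
  have [measurable]: "Measurable.pred M (\<lambda>\<omega>. below l (\<lambda>j. walk_X s Z j \<omega>) k)" for k
    by (rule below_measurable) simp
  \<comment> \<open>The value \<open>- 1\<close> is a marker for paths that have crossed by time
    \<open>k\<close>; it makes \<open>0 < Q\<close> equivalent to not having crossed.\<close>
  define Q where "Q = (\<lambda>\<omega>. if below l (\<lambda>j. walk_X s Z j \<omega>) k then l - walk_X s Z k \<omega> else - 1)"
  let ?c = "\<lambda>z j. walk_X s (\<lambda>i z. z i) j z"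
  have [measurable]: "(\<lambda>z. ?c z j) \<in> borel_measurable (PiM {1..k} (\<lambda>_. borel))" if "j \<le> k" for j
    using walk_X_PiM_measurable[of "\<lambda>x. x" borel j k] that by simp
  have [measurable]: "Measurable.pred (PiM {1..k} (\<lambda>_. borel)) (\<lambda>z. below l (?c z) k)"
    by (rule below_measurable) measurable
  have "indep_var borel (\<lambda>\<omega>. (\<lambda>z. if below l (?c z) k then l - ?c z k else - 1) (\<lambda>i\<in>{1..k}. Z i \<omega>)) borel (\<lambda>\<omega>. Z (Suc k) \<omega>)"
    by (rule indep_var_past_next[OF Z]) measurable
  also have "(\<lambda>\<omega>. (\<lambda>z. if below l (?c z) k then l - ?c z k else - 1) (\<lambda>i\<in>{1..k}. Z i \<omega>)) = Q"
    by (auto simp: Q_def below_def walk_X_restrict[of _ k s "\<lambda>x. x"] fun_eq_iff simp del: One_nat_def)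
  finally have ind: "indep_var borel Q borel (Z (Suc k))" by simp
  have Q0: "0 < Q \<omega> \<longleftrightarrow> below l (\<lambda>j. walk_X s Z j \<omega>) k" for \<omega>
    by (auto simp: Q_def dest: below_imp_less)
  have e1: "of_bool (below l (\<lambda>j. walk_X s Z j \<omega>) k) * max 0 (walk_X s Z (Suc k) \<omega> - l)
      = of_bool (0 < Q \<omega>) * max 0 (s + Z (Suc k) \<omega> - Q \<omega>)" for \<omega>
    by (auto simp: Q0) (auto simp: Q_def walk_X_Suc algebra_simps)
  have e2: "0 < Q \<omega> \<and> Q \<omega> \<le> s + Z (Suc k) \<omega> \<longleftrightarrow>
      below l (\<lambda>j. walk_X s Z j \<omega>) k \<and> \<not> below l (\<lambda>j. walk_X s Z j \<omega>) (Suc k)" for \<omega>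
    unfolding Q0 by (auto simp: below_Suc Q_def walk_X_Suc)
  let ?A = "{\<omega> \<in> space M. below l (\<lambda>j. walk_X s Z j \<omega>) k \<and> \<not> below l (\<lambda>j. walk_X s Z j \<omega>) (Suc k)}"
  have int: "integrable M (\<lambda>\<omega>. of_bool (below l (\<lambda>j. walk_X s Z j \<omega>) k) * max 0 (walk_X s Z (Suc k) \<omega> - l))"
    using walk_X_integrable[OF D v] by (intro integrable_of_bool_mult) auto
  have "ennreal (expectation (\<lambda>\<omega>. of_bool (below l (\<lambda>j. walk_X s Z j \<omega>) k) * max 0 (walk_X s Z (Suc k) \<omega> - l)))
      = (\<integral>\<^sup>+\<omega>. ennreal (of_bool (0 < Q \<omega>) * max 0 (s + Z (Suc k) \<omega> - Q \<omega>)) \<partial>M)"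
    using int by (subst nn_integral_eq_integral[symmetric]) (auto simp: e1)
  also have "\<dots> \<le> ennreal (s + v) * (\<integral>\<^sup>+\<omega>. ennreal (of_bool (0 < Q \<omega> \<and> Q \<omega> \<le> s + Z (Suc k) \<omega>)) \<partial>M)"
    by (rule normal_mean_excess[OF ind D v s]) simp
  also have "(\<integral>\<^sup>+\<omega>. ennreal (of_bool (0 < Q \<omega> \<and> Q \<omega> \<le> s + Z (Suc k) \<omega>)) \<partial>M) = (\<integral>\<^sup>+\<omega>. indicator ?A \<omega> \<partial>M)"
    unfolding e2 by (rule nn_integral_cong) (simp add: indicator_def)
  also have "\<dots> = emeasure M ?A" by simp
  also have "ennreal (s + v) * emeasure M ?A = ennreal ((s + v) * prob ?A)"
    using s v by (simp add: emeasure_eq_measure ennreal_mult)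
  finally have "expectation (\<lambda>\<omega>. of_bool (below l (\<lambda>j. walk_X s Z j \<omega>) k) * max 0 (walk_X s Z (Suc k) \<omega> - l)) \<le> (s + v) * prob ?A"
    using s v by (subst (asm) ennreal_le_iff) auto
  also have "prob ?A = prob_below l (walk_X s Z) k - prob_below l (walk_X s Z) (Suc k)"
    by (subst finite_measure_Diff[symmetric]) (auto simp: below_Suc intro!: arg_cong[where f=prob])
  finally show ?thesis .
qed

text \<open>The probabilities of crossing at the successive times telescope to at most 1, so the
  bound does not depend on \<open>n\<close>.\<close>

lemma overshoot_sum:
  assumes Z: "indep_vars (\<lambda>_. borel) Z {1..}"
    and D: "\<And>i. 1 \<le> i \<Longrightarrow> distributed M lborel (Z i) (normal_density 0 v)" and v: "0 < v" and s: "0 \<le> s"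
  shows "(\<Sum>k<n. expectation (\<lambda>\<omega>. of_bool (below l (\<lambda>j. walk_X s Z j \<omega>) k) * max 0 (walk_X s Z (Suc k) \<omega> - l))) \<le> s + v"
proof -
  have "(\<Sum>k<n. expectation (\<lambda>\<omega>. of_bool (below l (\<lambda>j. walk_X s Z j \<omega>) k) * max 0 (walk_X s Z (Suc k) \<omega> - l)))
      \<le> (\<Sum>k<n. (s + v) * (prob_below l (walk_X s Z) k - prob_below l (walk_X s Z) (Suc k)))"
    by (intro sum_mono overshoot_step[OF Z D v s]) auto
  also have "\<dots> = (s + v) * (prob_below l (walk_X s Z) 0 - prob_below l (walk_X s Z) n)"
    by (subst sum_distrib_left[symmetric]) (subst sum_lessThan_telescope'[of "prob_below l (walk_X s Z)"], rule refl)
  also have "\<dots> \<le> (s + v) * 1"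
    using s v prob_le_1[of "{\<omega> \<in> space M. below l (\<lambda>j. walk_X s Z j \<omega>) 0}"]
      measure_nonneg[of M "{\<omega> \<in> space M. below l (\<lambda>j. walk_X s Z j \<omega>) n}"]
    by (intro mult_left_mono) linarith+
  finally show ?thesis by simp
qed

end

text \<open>With \<open>q k\<close> the probability that a time \<eta> exceeds \<open>k\<close>, the
  left side is the mean of sqrt \<eta> on the event that \<eta> is at most \<open>n\<close>.
  Jensen's inequality is replaced by the tangent bound \<open>sqrt m \<le> (m / A + A) / 2\<close>,
  and summation by parts turns the mean of \<eta> back into a sum of the \<open>q k\<close>.\<close>

lemma weighted_sqrt_sum_le:
  fixes q :: "nat \<Rightarrow> real"
  assumes dec: "\<And>k. q (Suc k) \<le> q k" and q: "\<And>k. 0 \<le> q k" "q 0 \<le> 1"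
    and sum: "(\<Sum>k<n. q k) \<le> A\<^sup>2" and A: "0 < A"
  shows "(\<Sum>k<n. (q k - q (Suc k)) * sqrt (real (Suc k))) \<le> A"
proof -
  have abel: "(\<Sum>k<n. (q k - q (Suc k)) * real (Suc k)) = (\<Sum>k<n. q k) - n * q n"
    by (induction n) (auto simp: algebra_simps)
  have "sqrt (real (Suc k)) \<le> (real (Suc k) / A + A) / 2" for k
  proof -
    have "2 * sqrt (real (Suc k)) * A \<le> (sqrt (real (Suc k)))\<^sup>2 + A\<^sup>2"
      by (rule sum_squares_bound)
    then show ?thesis using A by (simp add: field_simps power2_eq_square)
  qed
  then have "(\<Sum>k<n. (q k - q (Suc k)) * sqrt (real (Suc k))) \<le> (\<Sum>k<n. (q k - q (Suc k)) * ((real (Suc k) / A + A) / 2))"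
    using dec by (intro sum_mono mult_left_mono) (auto simp: le_diff_eq)
  also have "\<dots> = (\<Sum>k<n. (q k - q (Suc k)) * real (Suc k) / (2 * A) + (q k - q (Suc k)) * (A / 2))"
    using A by (intro sum.cong) (auto simp: field_simps)
  also have "\<dots> = (\<Sum>k<n. (q k - q (Suc k)) * real (Suc k)) / (2 * A) + (\<Sum>k<n. q k - q (Suc k)) * (A / 2)"
    by (simp add: sum.distrib sum_divide_distrib sum_distrib_right)
  also have "\<dots> = ((\<Sum>k<n. q k) - n * q n) / (2 * A) + (q 0 - q n) * (A / 2)"
    by (simp only: abel sum_lessThan_telescope')
  also have "\<dots> \<le> A\<^sup>2 / (2 * A) + 1 * (A / 2)"
  proof (intro add_mono divide_right_mono mult_right_mono)
    show "(\<Sum>k<n. q k) - n * q n \<le> A\<^sup>2" using sum q(1)[of n] by (smt (verit) mult_nonneg_nonneg of_nat_0_le_iff)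
    show "q 0 - q n \<le> 1" using q(1)[of n] q(2) by linarith
  qed (use A in auto)
  also have "\<dots> = A" using A by (simp add: power2_eq_square)
  finally show ?thesis .
qed

section \<open>Optional stopping for one walk and for two coupled walks\<close>

context prob_space begin

lemma prob_below_bounds:
  assumes [measurable]: "\<And>k. X k \<in> borel_measurable M"
  shows "prob_below l X (Suc k) \<le> prob_below l X k"
  and "prob {\<omega> \<in> space M. below l (\<lambda>j. X j \<omega>) k \<and> l \<le> X (Suc k) \<omega>} = prob_below l X k - prob_below l X (Suc k)"
proof -
  have [measurable]: "Measurable.pred M (\<lambda>\<omega>. below l (\<lambda>j. X j \<omega>) k)" for k
    by (rule below_measurable) simp
  show "prob_below l X (Suc k) \<le> prob_below l X k"
    by (intro finite_measure_mono) (auto simp: below_Suc)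
  show "prob {\<omega> \<in> space M. below l (\<lambda>j. X j \<omega>) k \<and> l \<le> X (Suc k) \<omega>} = prob_below l X k - prob_below l X (Suc k)"
    by (subst finite_measure_Diff[symmetric]) (auto simp: below_Suc intro!: arg_cong[where f=prob])
qed

text \<open>Wald's identity for the crossing time truncated at \<open>n\<close>. The event of not
  having crossed by time \<open>k\<close> is determined by the first \<open>k\<close> increments,
  hence independent of the next one.\<close>

lemma stopped_walk_expectation:
  fixes Z :: "nat \<Rightarrow> 'a \<Rightarrow> real" and l s v :: real
  assumes Z: "indep_vars (\<lambda>_. borel) Z {1..}"
    and D: "\<And>i. 1 \<le> i \<Longrightarrow> distributed M lborel (Z i) (normal_density 0 v)" and v: "0 < v"
  defines "S \<equiv> \<lambda>n \<omega>. \<Sum>k<n. of_bool (below l (\<lambda>j. walk_X s Z j \<omega>) k) * (walk_X s Z (Suc k) \<omega> - walk_X s Z k \<omega>)"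
  shows "integrable M (S n)" "expectation (S n) = s * (\<Sum>k<n. prob_below l (walk_X s Z) k)"
proof -
  note [measurable] = walk_X_measurable[OF Z]
  have [measurable]: "Measurable.pred M (\<lambda>\<omega>. below l (\<lambda>j. walk_X s Z j \<omega>) k)" for k
    by (rule below_measurable) simp
  have ind: "indep_var borel (\<lambda>\<omega>. of_bool (below l (\<lambda>j. walk_X s Z j \<omega>) k) :: real) borel (Z (Suc k))" for k
  proof -
    let ?c = "\<lambda>z j. walk_X s (\<lambda>i z. z i) j z"
    have [measurable]: "(\<lambda>z. ?c z j) \<in> borel_measurable (PiM {1..k} (\<lambda>_. borel))" if "j \<le> k" for j
      using walk_X_PiM_measurable[of "\<lambda>x. x" borel j k] that by simp
    have [measurable]: "Measurable.pred (PiM {1..k} (\<lambda>_. borel)) (\<lambda>z. below l (?c z) k)"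
      by (rule below_measurable) measurable
    have "indep_var borel (\<lambda>\<omega>. (\<lambda>z. of_bool (below l (?c z) k) :: real) (\<lambda>i\<in>{1..k}. Z i \<omega>)) borel (\<lambda>\<omega>. Z (Suc k) \<omega>)"
      by (rule indep_var_past_next[OF Z]) measurable
    also have "(\<lambda>\<omega>. (\<lambda>z. of_bool (below l (?c z) k) :: real) (\<lambda>i\<in>{1..k}. Z i \<omega>)) = (\<lambda>\<omega>. of_bool (below l (\<lambda>j. walk_X s Z j \<omega>) k))"
      by (auto simp: below_def walk_X_restrict[of _ k s "\<lambda>x. x"] fun_eq_iff simp del: One_nat_def)
    finally show ?thesis by simp
  qed
  note drift = drift_expectation[OF ind _ normal_integrable[OF D v]]
  have S: "S n = (\<lambda>\<omega>. \<Sum>k<n. of_bool (below l (\<lambda>j. walk_X s Z j \<omega>) k) * (s + Z (Suc k) \<omega>))"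
    by (simp add: S_def walk_X_Suc)
  show "integrable M (S n)"
    unfolding S by (intro Bochner_Integration.integrable_sum drift) auto
  show "expectation (S n) = s * (\<Sum>k<n. prob_below l (walk_X s Z) k)"
    unfolding S by (subst Bochner_Integration.integral_sum) (auto simp: drift sum_distrib_left)
qed

text \<open>Wald's identity combined with the fact that the stopped walk exceeds \<open>l\<close> by
  at most the overshoot. The bound is uniform in \<open>n\<close>.\<close>

lemma mean_below_upper:
  assumes Z: "indep_vars (\<lambda>_. borel) Z {1..}"
    and D: "\<And>i. 1 \<le> i \<Longrightarrow> distributed M lborel (Z i) (normal_density 0 v)" and v: "0 < v" and s: "0 \<le> s"
    and l: "0 < l"
  shows "s * (\<Sum>k<n. prob_below l (walk_X s Z) k) \<le> l + (s + v)"
proof -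
  note [measurable] = walk_X_measurable[OF Z]
  have [measurable]: "Measurable.pred M (\<lambda>\<omega>. below l (\<lambda>j. walk_X s Z j \<omega>) k)" for k
    by (rule below_measurable) simp
  have int: "integrable M (\<lambda>\<omega>. of_bool (below l (\<lambda>j. walk_X s Z j \<omega>) k) * max 0 (walk_X s Z (Suc k) \<omega> - l))" for k
    using walk_X_integrable[OF D v] by (intro integrable_of_bool_mult) auto
  note S = stopped_walk_expectation[OF Z D v, where l=l and s=s and n=n]
  have "s * (\<Sum>k<n. prob_below l (walk_X s Z) k) = expectation (\<lambda>\<omega>. (\<Sum>k<n. of_bool (below l (\<lambda>j. walk_X s Z j \<omega>) k) * (walk_X s Z (Suc k) \<omega> - walk_X s Z k \<omega>)))"
    using S(2) by simp
  also have "\<dots> \<le> expectation (\<lambda>\<omega>. l + (\<Sum>k<n. of_bool (below l (\<lambda>j. walk_X s Z j \<omega>) k) * max 0 (walk_X s Z (Suc k) \<omega> - l)))"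
  proof (rule integral_mono[OF S(1)])
    show "integrable M (\<lambda>\<omega>. l + (\<Sum>k<n. of_bool (below l (\<lambda>j. walk_X s Z j \<omega>) k) * max 0 (walk_X s Z (Suc k) \<omega> - l)))"
      by (intro Bochner_Integration.integrable_add Bochner_Integration.integrable_sum int) simp
    show "(\<Sum>k<n. of_bool (below l (\<lambda>j. walk_X s Z j \<omega>) k) * (walk_X s Z (Suc k) \<omega> - walk_X s Z k \<omega>)) \<le> l + (\<Sum>k<n. of_bool (below l (\<lambda>j. walk_X s Z j \<omega>) k) * max 0 (walk_X s Z (Suc k) \<omega> - l))" for \<omega>
      using stopped_sum[where x="\<lambda>j. walk_X s Z j \<omega>" and l=l and n=n] l by simp
  qed
  also have "\<dots> = l + (\<Sum>k<n. expectation (\<lambda>\<omega>. of_bool (below l (\<lambda>j. walk_X s Z j \<omega>) k) * max 0 (walk_X s Z (Suc k) \<omega> - l)))"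
    using int by (subst Bochner_Integration.integral_add)
      (simp_all only: Bochner_Integration.integral_sum Bochner_Integration.integrable_sum integrable_const
        lebesgue_integral_const prob_space scaleR_one)
  also have "\<dots> \<le> l + (s + v)"
    using overshoot_sum[OF Z D v s] by simp
  finally show ?thesis .
qed

text \<open>A Markov-type bound by the fourth moment of the centred sum. It decays like 1 / n when
  \<open>s > 0\<close>, whereas the analogous bound by the second moment would only stay
  bounded.\<close>

lemma walk_X_lower_tail:
  assumes Z: "indep_vars (\<lambda>_. borel) Z {1..}"
    and D: "\<And>i. 1 \<le> i \<Longrightarrow> distributed M lborel (Z i) (normal_density 0 v)" and v: "0 < v"
    and n: "0 < n" "l < s * real n"
  shows "expectation (\<lambda>\<omega>. max 0 (l - walk_X s Z n \<omega>)) \<le> 3 * v ^ 4 * (real n)\<^sup>2 / (s * real n - l) ^ 3"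
proof -
  let ?B = "\<lambda>\<omega>. \<Sum>i=1..n. Z i \<omega>"
  define a where "a = s * real n - l"
  have a: "0 < a" using n by (simp add: a_def)
  have sd: "0 < sqrt (real n * v\<^sup>2)" using n v by simp
  have "distributed M lborel ?B (normal_density (\<Sum>i=1..n. 0) (sqrt (\<Sum>i=1..n. v\<^sup>2)))"
    using n v by (intro sum_indep_normal indep_vars_subset[OF Z] D) auto
  then have B: "distributed M lborel ?B (normal_density 0 (sqrt (real n * v\<^sup>2)))" by simp
  have four: "has_bochner_integral lborel (\<lambda>x. normal_density 0 (sqrt (real n * v\<^sup>2)) x * x ^ 4) (3 * v ^ 4 * (real n)\<^sup>2)"
    using normal_moment_even[OF sd, of 0 2] n v
    by (simp add: fact_numeral power_mult_distrib field_simps)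
  have int4: "integrable M (\<lambda>\<omega>. ?B \<omega> ^ 4)"
    using distributed_integrable[OF B, of "\<lambda>x. x ^ 4"] four by (auto simp: has_bochner_integral_iff)
  have E4: "expectation (\<lambda>\<omega>. ?B \<omega> ^ 4) = 3 * v ^ 4 * (real n)\<^sup>2"
    using distributed_integral[OF B, of "\<lambda>x. x ^ 4"] four by (auto simp: has_bochner_integral_iff)
  \<comment> \<open>The left side is positive only if \<open>- b > a\<close>; then \<bar>b\<bar> is
    \<open>b ^ 4\<close> divided by \<bar>b\<bar> cubed, and the latter is at least
    \<open>a ^ 3\<close>.\<close>
  have pw: "max 0 (- a - b) \<le> b ^ 4 / a ^ 3" for b :: real
  proof (cases "- b \<le> a")
    case False
    then have "a ^ 3 \<le> (- b) ^ 3" using a by (intro power_mono) auto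
    then have "(- b) * a ^ 3 \<le> (- b) * (- b) ^ 3" using False a by (intro mult_left_mono) auto
    also have "\<dots> = b ^ 4" by (simp add: eval_nat_numeral)
    finally have "- b \<le> b ^ 4 / a ^ 3" using a by (simp add: field_simps)
    then show ?thesis using a False by simp
  qed (use a in auto)
  have "expectation (\<lambda>\<omega>. max 0 (l - walk_X s Z n \<omega>)) \<le> expectation (\<lambda>\<omega>. ?B \<omega> ^ 4 / a ^ 3)"
  proof (rule integral_mono)
    show "integrable M (\<lambda>\<omega>. max 0 (l - walk_X s Z n \<omega>))"
      using walk_X_integrable[OF D v] by auto
    show "max 0 (l - walk_X s Z n \<omega>) \<le> ?B \<omega> ^ 4 / a ^ 3" for \<omega>
      using pw[of "?B \<omega>"] by (simp add: a_def walk_X_def algebra_simps)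
  qed (use int4 in simp)
  also have "\<dots> = 3 * v ^ 4 * (real n)\<^sup>2 / a ^ 3" by (simp add: E4 del: One_nat_def)
  finally show ?thesis unfolding a_def .
qed

text \<open>The stopped walk is at least \<open>l\<close> up to its deficit at time \<open>n\<close>
  on paths that have not crossed. For positive drift the deficit vanishes in mean as
  \<open>n\<close> grows, which leaves the lower bound \<open>l / s\<close> for the mean crossing
  time.\<close>

lemma mean_below_lower:
  assumes Z: "indep_vars (\<lambda>_. borel) Z {1..}"
    and D: "\<And>i. 1 \<le> i \<Longrightarrow> distributed M lborel (Z i) (normal_density 0 v)" and v: "0 < v"
    and l: "0 < l" and n: "l < s * real n"
  shows "l - 3 * v ^ 4 * (real n)\<^sup>2 / (s * real n - l) ^ 3 \<le> s * (\<Sum>k<n. prob_below l (walk_X s Z) k)"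
proof -
  have n0: "0 < n" using l n by (cases n) auto
  note S = stopped_walk_expectation[OF Z D v, where l=l and s=s and n=n]
  have int: "integrable M (\<lambda>\<omega>. max 0 (l - walk_X s Z n \<omega>))"
    using walk_X_integrable[OF D v] by auto
  have "l - 3 * v ^ 4 * (real n)\<^sup>2 / (s * real n - l) ^ 3 \<le> expectation (\<lambda>\<omega>. l - max 0 (l - walk_X s Z n \<omega>))"
    using walk_X_lower_tail[OF Z D v n0 n] int by (simp add: prob_space)
  also have "\<dots> \<le> expectation (\<lambda>\<omega>. (\<Sum>k<n. of_bool (below l (\<lambda>j. walk_X s Z j \<omega>) k) * (walk_X s Z (Suc k) \<omega> - walk_X s Z k \<omega>)))"
  proof (rule integral_mono[OF _ S(1)])
    show "l - max 0 (l - walk_X s Z n \<omega>) \<le> (\<Sum>k<n. of_bool (below l (\<lambda>j. walk_X s Z j \<omega>) k) * (walk_X s Z (Suc k) \<omega> - walk_X s Z k \<omega>))" for \<omega>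
      using stopped_sum_ge[where x="\<lambda>j. walk_X s Z j \<omega>" and l=l and n=n] l by simp
  qed (use int in simp)
  also have "\<dots> = s * (\<Sum>k<n. prob_below l (walk_X s Z) k)"
    using S(2) by simp
  finally show ?thesis .
qed

lemma expectation_normal_positive_part:
  assumes D: "distributed M lborel Z (normal_density 0 v)" and v: "0 < v"
  shows "expectation (\<lambda>\<omega>. max 0 (Z \<omega>)) = v * sqrt (2 / pi) / 2"
proof -
  have a: "has_bochner_integral lborel (\<lambda>x. normal_density 0 v x * \<bar>x\<bar>) (v * sqrt (2 / pi))"
    using normal_moment_abs_odd[OF v, of 0 0] by simp
  have "integrable M (\<lambda>\<omega>. \<bar>Z \<omega>\<bar>)" "expectation (\<lambda>\<omega>. \<bar>Z \<omega>\<bar>) = v * sqrt (2 / pi)"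
    using distributed_integrable[OF D, of abs] distributed_integral[OF D, of abs] a
    by (auto simp: has_bochner_integral_iff)
  moreover have "(\<lambda>\<omega>. max 0 (Z \<omega>)) = (\<lambda>\<omega>. (\<bar>Z \<omega>\<bar> + Z \<omega>) / 2)" by (auto simp: fun_eq_iff max_def)
  ultimately show ?thesis using normal_integrable[OF D v] by simp
qed


text \<open>Optional stopping for \<open>x\<close> between the crossing of \<open>y\<close> and its
  own later crossing; the sum on the left is the mean length of that interval, truncated at
  \<open>n\<close>. Both walks are driven by one sequence \<open>Z\<close> through \<open>f\<close>
  and \<open>g\<close>, so that the past of \<open>Z\<close> determines both and is independent of
  the next increment of \<open>x\<close>.\<close>

lemma between_walks:
  fixes Z :: "nat \<Rightarrow> 'a \<Rightarrow> 'b" and f g :: "'b \<Rightarrow> real" and s l v w :: real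
  defines "x \<equiv> walk_X s (\<lambda>i \<omega>. f (Z i \<omega>))" and "y \<equiv> walk_X s (\<lambda>i \<omega>. g (Z i \<omega>))"
  assumes Z: "indep_vars (\<lambda>_. N) Z {1..}"
    and f[measurable]: "f \<in> measurable N borel" and g[measurable]: "g \<in> measurable N borel"
    and F: "\<And>i. 1 \<le> i \<Longrightarrow> distributed M lborel (\<lambda>\<omega>. f (Z i \<omega>)) (normal_density 0 v)" and v: "0 < v"
    and G: "\<And>i. 1 \<le> i \<Longrightarrow> distributed M lborel (\<lambda>\<omega>. g (Z i \<omega>)) (normal_density 0 w)" and w: "0 < w"
    and s: "0 \<le> s" and l: "0 < l"
  shows "s * (\<Sum>k<n. prob {\<omega> \<in> space M. \<not> below l (\<lambda>j. y j \<omega>) k \<and> below l (\<lambda>j. x j \<omega>) k})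
    \<le> s + v + (\<Sum>k<n. expectation (\<lambda>\<omega>. of_bool (below l (\<lambda>j. y j \<omega>) k \<and> l \<le> y (Suc k) \<omega>) * max 0 (y (Suc k) \<omega> - x (Suc k) \<omega>)))"
proof -
  have fZ: "indep_vars (\<lambda>_. borel) (\<lambda>i \<omega>. f (Z i \<omega>)) {1..}" and gZ: "indep_vars (\<lambda>_. borel) (\<lambda>i \<omega>. g (Z i \<omega>)) {1..}"
    by (rule indep_vars_compose2[OF Z f], rule indep_vars_compose2[OF Z g])
  have mx[measurable]: "x k \<in> borel_measurable M" and my[measurable]: "y k \<in> borel_measurable M" for k
    unfolding x_def y_def by (rule walk_X_measurable[OF fZ], rule walk_X_measurable[OF gZ])
  have [measurable]: "Measurable.pred M (\<lambda>\<omega>. below l (\<lambda>j. x j \<omega>) k)" "Measurable.pred M (\<lambda>\<omega>. below l (\<lambda>j. y j \<omega>) k)" for k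
    by (rule below_measurable, simp)+
  have ix: "integrable M (x k)" and iy: "integrable M (y k)" for k
    unfolding x_def y_def by (rule walk_X_integrable[OF F v], simp, rule walk_X_integrable[OF G w], simp)
  let ?P = "\<lambda>k \<omega>. \<not> below l (\<lambda>j. y j \<omega>) k \<and> below l (\<lambda>j. x j \<omega>) k"
  have ind: "indep_var borel (\<lambda>\<omega>. of_bool (?P k \<omega>) :: real) borel (\<lambda>\<omega>. f (Z (Suc k) \<omega>))" for k
  proof -
    let ?x = "\<lambda>z j. walk_X s (\<lambda>i z. f (z i)) j z" and ?y = "\<lambda>z j. walk_X s (\<lambda>i z. g (z i)) j z"
    have [measurable]: "Measurable.pred (PiM {1..k} (\<lambda>_. N)) (\<lambda>z. below l (?x z) k)"
      "Measurable.pred (PiM {1..k} (\<lambda>_. N)) (\<lambda>z. below l (?y z) k)"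
      by (rule below_measurable, rule walk_X_PiM_measurable, simp_all only: f g)+
    have "indep_var borel (\<lambda>\<omega>. (\<lambda>z. of_bool (\<not> below l (?y z) k \<and> below l (?x z) k) :: real) (\<lambda>i\<in>{1..k}. Z i \<omega>))
        borel (\<lambda>\<omega>. f (Z (Suc k) \<omega>))"
      by (rule indep_var_past_next[OF Z]) measurable
    also have "(\<lambda>\<omega>. (\<lambda>z. of_bool (\<not> below l (?y z) k \<and> below l (?x z) k) :: real) (\<lambda>i\<in>{1..k}. Z i \<omega>)) = (\<lambda>\<omega>. of_bool (?P k \<omega>))"
      by (simp add: below_def walk_X_restrict[of _ k s] x_def y_def fun_eq_iff del: One_nat_def)
    finally show ?thesis .
  qed
  note drift = drift_expectation[OF ind _ normal_integrable[OF F v]]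
  let ?O = "\<lambda>k \<omega>. of_bool (below l (\<lambda>j. x j \<omega>) k) * max 0 (x (Suc k) \<omega> - l)"
  let ?D = "\<lambda>k \<omega>. of_bool (below l (\<lambda>j. y j \<omega>) k \<and> l \<le> y (Suc k) \<omega>) * max 0 (y (Suc k) \<omega> - x (Suc k) \<omega>)"
  have iO: "integrable M (?O k)" and iD: "integrable M (?D k)" for k
    using ix iy by (auto intro!: integrable_of_bool_mult)
  have xS: "x (Suc k) \<omega> - x k \<omega> = s + f (Z (Suc k) \<omega>)" for k \<omega>
    by (simp add: x_def walk_X_Suc)
  have "s * (\<Sum>k<n. prob {\<omega> \<in> space M. ?P k \<omega>}) = (\<Sum>k<n. expectation (\<lambda>\<omega>. of_bool (?P k \<omega>) * (s + f (Z (Suc k) \<omega>))))"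
    by (simp add: drift sum_distrib_left)
  also have "\<dots> = expectation (\<lambda>\<omega>. \<Sum>k<n. of_bool (?P k \<omega>) * (s + f (Z (Suc k) \<omega>)))"
    by (rule Bochner_Integration.integral_sum[symmetric]) (rule drift, simp_all)
  also have "\<dots> \<le> expectation (\<lambda>\<omega>. (\<Sum>k<n. ?O k \<omega>) + (\<Sum>k<n. ?D k \<omega>))"
  proof (rule integral_mono)
    show "integrable M (\<lambda>\<omega>. \<Sum>k<n. of_bool (?P k \<omega>) * (s + f (Z (Suc k) \<omega>)))"
      by (rule Bochner_Integration.integrable_sum) (rule drift, simp_all)
    show "integrable M (\<lambda>\<omega>. (\<Sum>k<n. ?O k \<omega>) + (\<Sum>k<n. ?D k \<omega>))"
      by (intro Bochner_Integration.integrable_add Bochner_Integration.integrable_sum iO iD)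
    show "(\<Sum>k<n. of_bool (?P k \<omega>) * (s + f (Z (Suc k) \<omega>))) \<le> (\<Sum>k<n. ?O k \<omega>) + (\<Sum>k<n. ?D k \<omega>)" for \<omega>
      using between_sum[where x="\<lambda>j. x j \<omega>" and y="\<lambda>j. y j \<omega>" and l=l and n=n] l
      by (simp only: xS) (simp add: x_def y_def)
  qed
  also have "\<dots> = (\<Sum>k<n. expectation (?O k)) + (\<Sum>k<n. expectation (?D k))"
    using iO iD by (subst Bochner_Integration.integral_add)
      (simp_all only: Bochner_Integration.integral_sum Bochner_Integration.integrable_sum)
  also have "(\<Sum>k<n. expectation (?O k)) \<le> s + v"
    unfolding x_def by (rule overshoot_sum[OF fZ F v s])
  finally show ?thesis by simp
qed

text \<open>The event that \<open>y\<close> crosses exactly at time \<open>Suc k\<close> depends on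
  \<open>U\<close> alone, so the expectation factors. The sum of \<open>Suc k\<close> terms of
  \<open>R\<close> is normal with standard deviation \<open>sqrt (Suc k) \<sigma>\<close>, and its
  mean positive part is that number divided by sqrt (2 pi).\<close>

lemma error_at_crossing:
  fixes U R :: "nat \<Rightarrow> 'a \<Rightarrow> real" and s l \<sigma> :: real
  defines "y \<equiv> walk_X s U"
  assumes ind: "indep_vars (\<lambda>_. borel) (\<lambda>(i, b). if b then U i else R i) ({1..} \<times> UNIV)"
    and R: "\<And>i. 1 \<le> i \<Longrightarrow> distributed M lborel (R i) (normal_density 0 \<sigma>)" and \<sigma>: "0 < \<sigma>"
  shows "expectation (\<lambda>\<omega>. of_bool (below l (\<lambda>j. y j \<omega>) k \<and> l \<le> y (Suc k) \<omega>) * max 0 (\<Sum>i=1..Suc k. R i \<omega>))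
    = (prob_below l y k - prob_below l y (Suc k)) * (sqrt (real (Suc k)) * \<sigma> * sqrt (2 / pi) / 2)"
proof -
  let ?G = "\<lambda>(i, b). if b then U i else R i" and ?n = "Suc k"
  have Uind: "indep_vars (\<lambda>_. borel) U {1..}" and Rind: "indep_vars (\<lambda>_. borel) R {1..}"
  proof -
    have "indep_vars (\<lambda>_. borel) (\<lambda>i. ?G (i, b)) {1..}" for b
    proof -
      have "indep_vars (\<lambda>i. PiM {(i, b)} (\<lambda>_. borel)) (\<lambda>i \<omega>. \<lambda>j\<in>{(i, b)}. ?G j \<omega>) {1..}"
        by (rule indep_vars_restrict[OF ind]) (auto simp: disjoint_family_on_def)
      then have "indep_vars (\<lambda>_. borel) (\<lambda>i \<omega>. (\<lambda>z. z (i, b)) (\<lambda>j\<in>{(i, b)}. ?G j \<omega>)) {1..}"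
        by (rule indep_vars_compose2) (rule measurable_component_singleton, simp)
      then show ?thesis by simp
    qed
    from this[of True] this[of False]
    show "indep_vars (\<lambda>_. borel) U {1..}" "indep_vars (\<lambda>_. borel) R {1..}" by simp_all
  qed
  have my[measurable]: "y k \<in> borel_measurable M" for k
    unfolding y_def by (rule walk_X_measurable[OF Uind])
  have [measurable]: "Measurable.pred M (\<lambda>\<omega>. below l (\<lambda>j. y j \<omega>) k)" for k
    by (rule below_measurable) simp
  \<comment> \<open>The index blocks \<open>I True\<close> and \<open>I False\<close> select the
    variables \<open>U\<close> and \<open>R\<close> up to time \<open>Suc k\<close>; they are
    disjoint, so the two restrictions are independent.\<close>
  define I where "I b = {1..?n} \<times> {b}" for b :: bool
  let ?y = "\<lambda>z j. walk_X s (\<lambda>i z. z (i, True)) j z"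
  let ?E = "\<lambda>z. of_bool (below l (?y z) k \<and> l \<le> ?y z ?n) :: real"
  let ?S = "\<lambda>z. max 0 (\<Sum>i=1..?n. z (i, False)) :: real"
  have [measurable]: "(\<lambda>z. ?y z j) \<in> borel_measurable (PiM (I True) (\<lambda>_. borel))" if "j \<le> ?n" for j
    unfolding walk_X_def using that
    by (intro borel_measurable_add borel_measurable_sum borel_measurable_const measurable_component_singleton)
       (auto simp: I_def)
  have [measurable]: "Measurable.pred (PiM (I True) (\<lambda>_. borel)) (\<lambda>z. below l (?y z) k)"
    by (rule below_measurable) measurable
  have E: "?E \<in> borel_measurable (PiM (I True) (\<lambda>_. borel))"
    by measurable
  have S: "?S \<in> borel_measurable (PiM (I False) (\<lambda>_. borel))"
    by (intro borel_measurable_max borel_measurable_sum borel_measurable_const measurable_component_singleton)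
       (auto simp: I_def)
  have "indep_var (PiM (I True) (\<lambda>_. borel)) (\<lambda>\<omega>. \<lambda>i\<in>I True. ?G i \<omega>) (PiM (I False) (\<lambda>_. borel)) (\<lambda>\<omega>. \<lambda>i\<in>I False. ?G i \<omega>)"
    by (rule indep_var_restrict[OF ind]) (auto simp: I_def)
  from indep_var_compose[OF this E S]
  have "indep_var borel (\<lambda>\<omega>. ?E (\<lambda>i\<in>I True. ?G i \<omega>)) borel (\<lambda>\<omega>. ?S (\<lambda>i\<in>I False. ?G i \<omega>))"
    by (simp add: comp_def)
  moreover have "?S (\<lambda>i\<in>I False. ?G i \<omega>) = max 0 (\<Sum>i=1..?n. R i \<omega>)" for \<omega>
    by (intro arg_cong[where f="max 0"] sum.cong) (auto simp: I_def)
  moreover have wr: "?y (\<lambda>i\<in>I True. ?G i \<omega>) j = y j \<omega>" if "j \<le> ?n" for j \<omega>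
    using that by (auto simp: y_def walk_X_def I_def intro!: sum.cong)
  then have "?E (\<lambda>i\<in>I True. ?G i \<omega>) = of_bool (below l (\<lambda>j. y j \<omega>) k \<and> l \<le> y ?n \<omega>)" for \<omega>
    by (simp add: below_def)
  ultimately have indep: "indep_var borel (\<lambda>\<omega>. of_bool (below l (\<lambda>j. y j \<omega>) k \<and> l \<le> y ?n \<omega>) :: real)
      borel (\<lambda>\<omega>. max 0 (\<Sum>i=1..?n. R i \<omega>))"
    by simp
  have "distributed M lborel (\<lambda>\<omega>. \<Sum>i=1..?n. R i \<omega>) (normal_density (\<Sum>i=1..?n. 0) (sqrt (\<Sum>i=1..?n. \<sigma>\<^sup>2)))"
    by (intro sum_indep_normal indep_vars_subset[OF Rind] R \<sigma>) auto
  then have D: "distributed M lborel (\<lambda>\<omega>. \<Sum>i=1..?n. R i \<omega>) (normal_density 0 (sqrt (real ?n) * \<sigma>))"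
    using \<sigma> by (simp add: real_sqrt_mult)
  have pos: "0 < sqrt (real ?n) * \<sigma>" using \<sigma> by simp
  have iE: "integrable M (\<lambda>\<omega>. of_bool (below l (\<lambda>j. y j \<omega>) k \<and> l \<le> y ?n \<omega>) :: real)"
    using integrable_of_bool_mult[of "\<lambda>_. 1" "\<lambda>\<omega>. below l (\<lambda>j. y j \<omega>) k \<and> l \<le> y ?n \<omega>"] by simp
  have iS: "integrable M (\<lambda>\<omega>. max 0 (\<Sum>i=1..?n. R i \<omega>))"
    using normal_integrable(1)[OF D pos] by (intro integrable_max) auto
  show ?thesis
    using indep_var_lebesgue_integral[OF indep iE iS] expectation_normal_positive_part[OF D pos]
      prob_below_bounds(2)[of y l k, OF my]
    by (simp add: expectation_of_bool)
qed

end

section \<open>Distance of the hitting times\<close>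

text \<open>The bridge from extended times to the events \<open>below\<close>. It covers paths that
  never reach the level, since the infimum over the empty set is infinite.\<close>

lemma hitting_time_le_iff: "hitting_time X l \<omega> \<le> enat k \<longleftrightarrow> \<not> below l (\<lambda>j. X j \<omega>) k"
proof
  assume "hitting_time X l \<omega> \<le> enat k"
  show "\<not> below l (\<lambda>j. X j \<omega>) k"
  proof
    assume "below l (\<lambda>j. X j \<omega>) k"
    then have "\<not> t \<le> k" if "l \<le> X t \<omega>" for t
      using that by (force simp: below_def)
    then have "enat (Suc k) \<le> hitting_time X l \<omega>"
      unfolding hitting_time_def by (intro INF_greatest) (auto simp: Suc_le_eq not_le)
    with \<open>hitting_time X l \<omega> \<le> enat k\<close> have "enat (Suc k) \<le> enat k" by (rule order_trans[rotated])
    then show False by simp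
  qed
next
  assume "\<not> below l (\<lambda>j. X j \<omega>) k"
  then obtain j where "j \<le> k" "l \<le> X j \<omega>" by (auto simp: below_def not_less)
  then show "hitting_time X l \<omega> \<le> enat k"
    unfolding hitting_time_def by (intro INF_lower2[of j]) auto
qed

text \<open>The distance of two times counts the indices \<open>k\<close> that separate them. If
  \<open>b\<close> is infinite, every \<open>k\<close> from \<open>a\<close> on separates and the
  sum diverges. Finiteness of \<open>a\<close> excludes the case of two infinite times, where the
  distance is infinite but no index separates.\<close>

lemma time_dist_le_suminf:
  assumes "a \<noteq> \<infinity>"
  shows "time_dist a b \<le> (\<Sum>k. ennreal (of_bool ((a \<le> enat k) \<noteq> (b \<le> enat k))))" (is "_ \<le> suminf ?f")
proof -
  obtain m where m: "a = enat m" using assms by (cases a) auto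
  have card: "of_nat (card A) \<le> suminf ?f" if "finite A" "\<And>k. k \<in> A \<Longrightarrow> (a \<le> enat k) \<noteq> (b \<le> enat k)" for A
  proof -
    have "?f k = 1" if "k \<in> A" for k
      using \<open>\<And>k. k \<in> A \<Longrightarrow> (a \<le> enat k) \<noteq> (b \<le> enat k)\<close>[OF that] by (simp only: of_bool_eq ennreal_1 not_False_eq_True)
    then have "of_nat (card A) = (\<Sum>k\<in>A. ?f k)" by (simp only: sum_constant mult_1_right cong: sum.cong)
    also have "\<dots> \<le> suminf ?f" by (rule sum_le_suminf) (use that(1) in auto)
    finally show ?thesis .
  qed
  show ?thesis
  proof (cases b)
    case (enat n)
    have "\<bar>real m - real n\<bar> = real (card ({m..<n} \<union> {n..<m}))"
      by (cases "m \<le> n") auto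
    then have "time_dist a b = of_nat (card ({m..<n} \<union> {n..<m}))"
      unfolding m enat time_dist_enat by (simp only: ennreal_of_nat_eq_real_of_nat)
    also have "\<dots> \<le> suminf ?f" by (rule card) (auto simp: m enat)
    finally show ?thesis .
  next
    case infinity
    have "of_nat N \<le> suminf ?f" for N
    proof -
      have "of_nat (card {m..<m + N}) \<le> suminf ?f" by (rule card) (auto simp: m infinity)
      then show ?thesis by (simp only: card_atLeastLessThan add_diff_cancel_left')
    qed
    then have "(SUP N. of_nat N :: ennreal) \<le> suminf ?f" by (rule SUP_least)
    then show ?thesis by (simp only: ennreal_SUP_of_nat_eq_top top_unique top_greatest)
  qed
qed

text \<open>Splitting the root of \<open>(l + s + v) / s\<close> into the roots of
  \<open>l / s\<close>, 1 and \<open>1 / s\<close> reproduces the leading term of the target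
  exactly. The other two pieces fit under the bracket, and the remaining constants are compared term
  by term.\<close>

lemma bound_arith:
  fixes s l \<epsilon> :: real
  assumes s: "0 < s" and l: "0 < l" and e: "0 < \<epsilon>"
  defines "v \<equiv> 1 / sqrt (1 + \<epsilon>\<^sup>2)"
  shows "3 + 2 / s + v / s + \<epsilon> * v * sqrt (2 / pi) * sqrt ((l + s + v) / s) / s \<le>
    sqrt (2 * l * \<epsilon>\<^sup>2 / (pi * s ^ 3 * (1 + \<epsilon>\<^sup>2)))
        + sqrt (4 * \<epsilon>\<^sup>2 / (s\<^sup>2 * (1 + \<epsilon>\<^sup>2)))
          * (3 * (l / (2 * pi * s ^ 3)) powr (1 / 4) + 3 * sqrt (3 / s) + sqrt (3 * s) + 6)
        + 4 / (s * sqrt (1 + \<epsilon>\<^sup>2)) + 4 / s + 4"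
proof -
  have v: "0 < v" "v \<le> 1" using e by (auto simp: v_def add_pos_nonneg)
  let ?\<sigma> = "\<epsilon> * v"
  have \<sigma>: "0 < ?\<sigma>" using e v by simp
  have m: "sqrt (2 * l * \<epsilon>\<^sup>2 / (pi * s ^ 3 * (1 + \<epsilon>\<^sup>2))) = ?\<sigma> * sqrt (2 / pi) * sqrt (l / s) / s"
  proof -
    have "2 * l * \<epsilon>\<^sup>2 / (pi * s ^ 3 * (1 + \<epsilon>\<^sup>2)) = \<epsilon>\<^sup>2 * (1 / (1 + \<epsilon>\<^sup>2)) * (2 / pi) * (l / s) / s\<^sup>2"
      by (simp add: power2_eq_square power3_eq_cube mult_ac)
    then show ?thesis using e s by (simp add: v_def real_sqrt_mult real_sqrt_divide)
  qed
  have c: "sqrt (4 * \<epsilon>\<^sup>2 / (s\<^sup>2 * (1 + \<epsilon>\<^sup>2))) = 2 * ?\<sigma> / s"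
    using e s by (simp add: v_def real_sqrt_mult real_sqrt_divide)
  have "sqrt ((l + s + v) / s) \<le> sqrt (l / s + (1 + 1 / s))"
    using s v by (simp add: field_simps)
  also have "\<dots> \<le> sqrt (l / s) + (sqrt 1 + sqrt (1 / s))"
    using s l by (intro order_trans[OF sqrt_add_le_add_sqrt] add_left_mono sqrt_add_le_add_sqrt) auto
  finally have A: "sqrt ((l + s + v) / s) \<le> sqrt (l / s) + (1 + sqrt (1 / s))" by simp
  have p1: "sqrt (2 / pi) \<le> 1" using pi_gt3 by simp
  have s1: "sqrt (1 / s) \<le> sqrt (3 / s)" "0 \<le> sqrt (1 / s)" using s by (auto simp: divide_right_mono)
  have "?\<sigma> * sqrt (2 / pi) * sqrt ((l + s + v) / s) / s \<le> ?\<sigma> * sqrt (2 / pi) * (sqrt (l / s) + (1 + sqrt (1 / s))) / s"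
    using A \<sigma> s by (intro divide_right_mono mult_left_mono) auto
  also have "\<dots> = ?\<sigma> * sqrt (2 / pi) * sqrt (l / s) / s + (?\<sigma> / s) * (sqrt (2 / pi) * (1 + sqrt (1 / s)))"
    by (simp add: ring_distribs add_divide_distrib)
  also have "(?\<sigma> / s) * (sqrt (2 / pi) * (1 + sqrt (1 / s))) \<le> (?\<sigma> / s) * (1 * (1 + sqrt (1 / s)))"
    using p1 \<sigma> s s1 by (intro mult_left_mono mult_right_mono) auto
  also have "\<dots> \<le> (?\<sigma> / s) * (2 * (3 * (l / (2 * pi * s ^ 3)) powr (1 / 4) + 3 * sqrt (3 / s) + sqrt (3 * s) + 6))"
  proof (intro mult_left_mono)
    have "0 \<le> (l / (2 * pi * s ^ 3)) powr (1 / 4)" "0 \<le> sqrt (3 * s)" using s by auto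
    moreover have "1 * (1 + x) \<le> 2 * (3 * p + 3 * q + r + 6)" if "0 \<le> p" "0 \<le> r" "x \<le> q" "0 \<le> x" for p q r x :: real
      using that by (smt (verit))
    ultimately show "1 * (1 + sqrt (1 / s)) \<le> 2 * (3 * (l / (2 * pi * s ^ 3)) powr (1 / 4) + 3 * sqrt (3 / s) + sqrt (3 * s) + 6)"
      using s1 by blast
  qed (use \<sigma> s in auto)
  finally have 1: "?\<sigma> * sqrt (2 / pi) * sqrt ((l + s + v) / s) / s
      \<le> ?\<sigma> * sqrt (2 / pi) * sqrt (l / s) / s
        + (2 * ?\<sigma> / s) * (3 * (l / (2 * pi * s ^ 3)) powr (1 / 4) + 3 * sqrt (3 / s) + sqrt (3 * s) + 6)"
    by (simp add: mult.assoc mult.left_commute)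
  have 2: "4 / (s * sqrt (1 + \<epsilon>\<^sup>2)) = 4 * (v / s)" by (simp add: v_def)
  have 3: "0 \<le> v / s" "0 \<le> 1 / s" using v s by auto
  have 4: "2 / s = 2 * (1 / s)" "4 / s = 4 * (1 / s)" by simp_all
  show ?thesis unfolding m c 2 4 using 1 3 by linarith
qed

section \<open>The coupled Gaussian sequences and the expected distance\<close>

context prob_space begin

text \<open>The two sequences are first merged into one independent family indexed by sequence and
  time, and then regrouped by time. The result is a single sequence of independent pairs, whose past
  determines both walks.\<close>

lemma gaussian_pair_family:
  assumes V: "indep_vars (\<lambda>_. borel) V {1..}" and W: "indep_vars (\<lambda>_. borel) W {1..}"
    and VW: "indep_seqs M V W"
  shows "indep_vars (\<lambda>_. borel \<Otimes>\<^sub>M borel) (\<lambda>i \<omega>. (V i \<omega> :: real, W i \<omega> :: real)) {1..}"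
    and "\<And>i. 1 \<le> i \<Longrightarrow> indep_var borel (V i) borel (W i)"
proof -
  let ?F = "\<lambda>b i. if b then V i else W i"
  have VW': "indep_var (\<Pi>\<^sub>M i\<in>{1..}. borel) (\<lambda>\<omega>. \<lambda>i\<in>{1..}. V i \<omega>) (\<Pi>\<^sub>M i\<in>{1..}. borel) (\<lambda>\<omega>. \<lambda>i\<in>{1..}. W i \<omega>)"
    using VW unfolding indep_seqs_def .
  have "indep_vars (\<lambda>b. PiM {1..} (\<lambda>_. borel)) (\<lambda>b \<omega>. \<lambda>i\<in>{1..}. ?F b i \<omega>) UNIV"
    using VW' unfolding indep_var_def
    by (rule indep_vars_cong[THEN iffD1, rotated -1]) (auto split: bool.split)
  then have "indep_vars (\<lambda>(b, i). borel) (\<lambda>(b, i). ?F b i) (UNIV \<times> {1..})"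
  proof (rule indep_vars_Sigma)
    show "indep_vars (\<lambda>_. borel) (?F b) {1..}" for b
      using V W by (cases b) simp_all
  qed
  then have F: "indep_vars (\<lambda>_. borel) (\<lambda>(b, i). ?F b i) (UNIV \<times> {1..})"
    by (simp add: case_prod_unfold)
  have "indep_vars (\<lambda>i. PiM (UNIV \<times> {i}) (\<lambda>_. borel)) (\<lambda>i \<omega>. \<lambda>j\<in>UNIV \<times> {i}. (case j of (b, i) \<Rightarrow> ?F b i) \<omega>) {1..}"
    by (rule indep_vars_restrict[OF F]) (auto simp: disjoint_family_on_def)
  then have "indep_vars (\<lambda>_. borel \<Otimes>\<^sub>M borel) (\<lambda>i \<omega>. (\<lambda>z. (z (True, i), z (False, i)))
      (\<lambda>j\<in>UNIV \<times> {i}. (case j of (b, i) \<Rightarrow> ?F b i) \<omega>)) {1..}"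
    by (rule indep_vars_compose2) (intro measurable_Pair measurable_component_singleton, auto)
  then show "indep_vars (\<lambda>_. borel \<Otimes>\<^sub>M borel) (\<lambda>i \<omega>. (V i \<omega>, W i \<omega>)) {1..}" by simp
  fix i :: nat assume i: "1 \<le> i"
  have c: "(\<lambda>z. z i) \<in> borel_measurable (PiM {1..} (\<lambda>_. borel :: real measure))"
    by (rule measurable_component_singleton) (use i in simp)
  show "indep_var borel (V i) borel (W i)"
    using indep_var_compose[OF VW' c c] i by (simp add: comp_def)
qed

text \<open>The rotation acts on each time separately: the blocks for different times stay
  independent, and inside a block \<open>indep_var_normal_rotation\<close> applies.
  \<open>indep_vars_Sigma\<close> joins the two levels.\<close>

lemma gaussian_rotation_family:
  fixes V W :: "nat \<Rightarrow> 'a \<Rightarrow> real"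
  assumes V: "std_gaussian_seq M V" and W: "std_gaussian_seq M W" and VW: "indep_seqs M V W" and e: "0 < \<epsilon>"
  defines "U \<equiv> \<lambda>i \<omega>. (V i \<omega> + \<epsilon> * W i \<omega>) / (1 + \<epsilon>\<^sup>2)"
  defines "R \<equiv> \<lambda>i \<omega>. U i \<omega> - V i \<omega>"
  shows "indep_vars (\<lambda>_. borel) (\<lambda>(i, b). if b then U i else R i) ({1..} \<times> UNIV)"
    and "\<And>i. 1 \<le> i \<Longrightarrow> distributed M lborel (U i) (normal_density 0 (1 / sqrt (1 + \<epsilon>\<^sup>2)))"
    and "\<And>i. 1 \<le> i \<Longrightarrow> distributed M lborel (R i) (normal_density 0 (\<epsilon> / sqrt (1 + \<epsilon>\<^sup>2)))"
proof -
  let ?G = "\<lambda>i b. if b then U i else R i"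
  note V' = V[unfolded std_gaussian_seq_def] and W' = W[unfolded std_gaussian_seq_def]
  note pair = gaussian_pair_family[OF conjunct1[OF V'] conjunct1[OF W'] VW]
  have rot: "indep_var borel (U i) borel (R i)"
    "distributed M lborel (U i) (normal_density 0 (1 / sqrt (1 + \<epsilon>\<^sup>2)))"
    "distributed M lborel (R i) (normal_density 0 (\<epsilon> / sqrt (1 + \<epsilon>\<^sup>2)))" if "1 \<le> i" for i
    unfolding U_def R_def
    using indep_var_normal_rotation[OF e pair(2)[OF that]] V' W' that by auto
  define T where "T = (\<lambda>(v, w). \<lambda>b\<in>UNIV. if b then (v + \<epsilon> * w) / (1 + \<epsilon>\<^sup>2) else (v + \<epsilon> * w) / (1 + \<epsilon>\<^sup>2) - v)"
  have T: "T \<in> measurable (borel \<Otimes>\<^sub>M borel) (PiM UNIV (\<lambda>_. borel))"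
    unfolding T_def case_prod_unfold by (intro measurable_restrict) auto
  have "indep_vars (\<lambda>i. PiM UNIV (\<lambda>_. borel)) (\<lambda>i \<omega>. T (V i \<omega>, W i \<omega>)) {1..}"
    by (rule indep_vars_compose2[OF pair(1) T])
  also have "(\<lambda>i \<omega>. T (V i \<omega>, W i \<omega>)) = (\<lambda>i \<omega>. \<lambda>b\<in>UNIV. ?G i b \<omega>)"
    by (simp add: T_def U_def R_def fun_eq_iff)
  finally have blocks: "indep_vars (\<lambda>i. PiM UNIV (\<lambda>_. borel)) (\<lambda>i \<omega>. \<lambda>b\<in>UNIV. ?G i b \<omega>) {1..}" .
  have "indep_vars (\<lambda>(i, b). borel) (\<lambda>(i, b). ?G i b) ({1..} \<times> UNIV)"
  proof (rule indep_vars_Sigma[OF blocks])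
    fix i :: nat assume "i \<in> {1..}"
    then have "indep_var borel (U i) borel (R i)" by (intro rot(1)) simp
    then show "indep_vars (\<lambda>_. borel) (?G i) UNIV"
      unfolding indep_var_def
      by (rule indep_vars_cong[THEN iffD1, rotated -1]) (auto split: bool.split)
  qed
  then show "indep_vars (\<lambda>_. borel) (\<lambda>(i, b). if b then U i else R i) ({1..} \<times> UNIV)"
    by (simp add: case_prod_unfold)
  show "distributed M lborel (U i) (normal_density 0 (1 / sqrt (1 + \<epsilon>\<^sup>2)))"
    "distributed M lborel (R i) (normal_density 0 (\<epsilon> / sqrt (1 + \<epsilon>\<^sup>2)))" if "1 \<le> i" for i
    using rot(2,3)[OF that] .
qed


text \<open>The constant collects \<open>2 (s + 1) / s\<close> from the overshoot of the true walk,
  \<open>(l + s + v) / s - l / s\<close> from the two mean crossing times, and \<open>2 / s\<close>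
  times the mean positive error at the crossing of the estimate.\<close>

lemma hitting_times_distance_bound:
  fixes V W :: "nat \<Rightarrow> 'a \<Rightarrow> real"
  assumes e: "0 < \<epsilon>" and s: "0 < s" and l: "0 < l"
    and V: "std_gaussian_seq M V" and W: "std_gaussian_seq M W" and VW: "indep_seqs M V W"
  defines "v \<equiv> 1 / sqrt (1 + \<epsilon>\<^sup>2)"
  shows "(\<integral>\<^sup>+ \<omega>. time_dist (hitting_time (est_X s \<epsilon> V W) l \<omega>) (hitting_time (walk_X s V) l \<omega>) \<partial>M)
    \<le> ennreal (3 + 2 / s + v / s + \<epsilon> * v * sqrt (2 / pi) * sqrt ((l + s + v) / s) / s)" (is "_ \<le> ennreal ?C")
proof -
  define U where "U = (\<lambda>i \<omega>. (V i \<omega> + \<epsilon> * W i \<omega>) / (1 + \<epsilon>\<^sup>2))"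
  define R where "R = (\<lambda>i \<omega>. U i \<omega> - V i \<omega>)"
  define x where "x = walk_X s V"
  define y where "y = walk_X s U"
  have d: "0 < 1 + \<epsilon>\<^sup>2" by (simp add: add_pos_nonneg)
  have v: "0 < v" and \<sigma>: "0 < \<epsilon> * v" using d e by (simp_all add: v_def)
  have VD: "distributed M lborel (V i) (normal_density 0 1)" if "1 \<le> i" for i
    using V that by (auto simp: std_gaussian_seq_def)
  have Vind: "indep_vars (\<lambda>_. borel) V {1..}" and Wind: "indep_vars (\<lambda>_. borel) W {1..}"
    using V W by (auto simp: std_gaussian_seq_def)
  note pair = gaussian_pair_family(1)[OF Vind Wind VW]
  note rot = gaussian_rotation_family[OF V W VW e]
  have UD: "distributed M lborel (U i) (normal_density 0 v)" if "1 \<le> i" for i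
    using rot(2)[OF that] by (simp add: v_def U_def)
  have RD: "distributed M lborel (R i) (normal_density 0 (\<epsilon> * v))" if "1 \<le> i" for i
    using rot(3)[OF that] by (simp add: v_def R_def U_def)
  have UR: "indep_vars (\<lambda>_. borel) (\<lambda>(i, b). if b then U i else R i) ({1..} \<times> UNIV)"
    using rot(1) unfolding R_def U_def .
  have Uind: "indep_vars (\<lambda>_. borel) U {1..}"
    using indep_vars_compose2[OF pair, of "\<lambda>_ (v, w). (v + \<epsilon> * w) / (1 + \<epsilon>\<^sup>2)" "\<lambda>_. borel"]
    by (simp add: U_def case_prod_unfold)
  have est: "est_X s \<epsilon> V W = y"
    using d by (auto simp: fun_eq_iff est_X_def obs_Y_def walk_X_def y_def U_def sum.distrib
        sum_divide_distrib[symmetric] sum_distrib_left[symmetric])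
  have mx[measurable]: "x k \<in> borel_measurable M" and my[measurable]: "y k \<in> borel_measurable M" for k
    unfolding x_def y_def by (rule walk_X_measurable[OF Vind], rule walk_X_measurable[OF Uind])
  have [measurable]: "Measurable.pred M (\<lambda>\<omega>. below l (\<lambda>j. x j \<omega>) k)" "Measurable.pred M (\<lambda>\<omega>. below l (\<lambda>j. y j \<omega>) k)" for k
    by (rule below_measurable, simp)+

  \<comment> \<open>With \<eta> the crossing time of \<open>y\<close> and \<tau> that of
    \<open>x\<close>, these are the probabilities of \<open>k < \<eta>\<close>, of
    \<open>\<eta> \<le> k < \<tau>\<close>, and of \<open>k\<close> separating the two times. The
    number \<open>A\<close> bounds the root of the mean of \<eta>.\<close>
  define q where "q = prob_below l y"
  define p where "p = (\<lambda>k. prob {\<omega> \<in> space M. \<not> below l (\<lambda>j. y j \<omega>) k \<and> below l (\<lambda>j. x j \<omega>) k})"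
  define r where "r = (\<lambda>k. prob {\<omega> \<in> space M. below l (\<lambda>j. y j \<omega>) k \<noteq> below l (\<lambda>j. x j \<omega>) k})"
  define A where "A = sqrt ((l + s + v) / s)"
  have A: "0 < A" "A\<^sup>2 = (l + s + v) / s" using s l v by (auto simp: A_def)
  have q_sum: "(\<Sum>k<n. q k) \<le> A\<^sup>2" for n
  proof -
    have "s * (\<Sum>k<n. q k) \<le> l + (s + v)"
      unfolding q_def y_def by (rule mean_below_upper[OF Uind UD v _ l]) (use s in auto)
    then show ?thesis using s by (simp add: A(2) field_simps)
  qed
  have p_sum: "s * (\<Sum>k<n. p k) \<le> s + 1 + \<epsilon> * v * sqrt (2 / pi) / 2 * A" for n
  proof -
    have diff: "y k \<omega> - x k \<omega> = (\<Sum>i=1..k. R i \<omega>)" for k \<omega>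
      by (simp add: x_def y_def walk_X_def R_def sum_subtractf)
    have "s * (\<Sum>k<n. p k) \<le> s + 1 + (\<Sum>k<n. expectation (\<lambda>\<omega>. of_bool (below l (\<lambda>j. y j \<omega>) k \<and> l \<le> y (Suc k) \<omega>) * max 0 (y (Suc k) \<omega> - x (Suc k) \<omega>)))"
      using between_walks[OF pair, of fst "\<lambda>(v, w). (v + \<epsilon> * w) / (1 + \<epsilon>\<^sup>2)" 1 v s l n] VD UD v s l
      by (simp add: p_def x_def y_def U_def case_prod_unfold)
    also have "(\<Sum>k<n. expectation (\<lambda>\<omega>. of_bool (below l (\<lambda>j. y j \<omega>) k \<and> l \<le> y (Suc k) \<omega>) * max 0 (y (Suc k) \<omega> - x (Suc k) \<omega>)))
        = (\<Sum>k<n. (q k - q (Suc k)) * (sqrt (real (Suc k)) * (\<epsilon> * v) * sqrt (2 / pi) / 2))"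
      unfolding diff unfolding q_def y_def by (rule sum.cong[OF refl]) (rule error_at_crossing[OF UR RD \<sigma>])
    also have "\<dots> = \<epsilon> * v * sqrt (2 / pi) / 2 * (\<Sum>k<n. (q k - q (Suc k)) * sqrt (real (Suc k)))"
      by (simp add: sum_distrib_left mult_ac)
    also have "\<dots> \<le> \<epsilon> * v * sqrt (2 / pi) / 2 * A"
    proof (rule mult_left_mono[OF weighted_sqrt_sum_le])
      show "q (Suc k) \<le> q k" for k unfolding q_def by (rule prob_below_bounds) simp
    qed (use q_sum A \<sigma> in \<open>auto simp: q_def\<close>)
    finally show ?thesis by simp
  qed
  \<comment> \<open>For events \<open>B\<close> and \<open>C\<close>, the indicator of their
    difference in truth value equals twice that of \<open>C\<close> without \<open>B\<close>, plus
    that of \<open>B\<close>, minus that of \<open>C\<close>. The subtracted term is moved to the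
    left before integrating.\<close>
  have r_eq: "r k = 2 * p k + q k - prob_below l x k" for k
  proof -
    have i: "integrable M (\<lambda>\<omega>. of_bool (P \<omega>) :: real)" if "Measurable.pred M P" for P
      using integrable_of_bool_mult[of "\<lambda>_. 1", OF _ that] by simp
    have "r k + prob_below l x k = expectation (\<lambda>\<omega>. of_bool (below l (\<lambda>j. y j \<omega>) k \<noteq> below l (\<lambda>j. x j \<omega>) k) + of_bool (below l (\<lambda>j. x j \<omega>) k))"
      by (subst Bochner_Integration.integral_add) (simp_all add: i expectation_of_bool r_def)
    also have "\<dots> = expectation (\<lambda>\<omega>. 2 * of_bool (\<not> below l (\<lambda>j. y j \<omega>) k \<and> below l (\<lambda>j. x j \<omega>) k) + of_bool (below l (\<lambda>j. y j \<omega>) k))"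
      by (rule Bochner_Integration.integral_cong) auto
    also have "\<dots> = 2 * p k + q k"
      by (subst Bochner_Integration.integral_add) (simp_all add: i expectation_of_bool p_def q_def)
    finally show ?thesis by simp
  qed
  \<comment> \<open>The lower bound for the mean of \<tau> truncated at \<open>m\<close> carries an
    error \<open>?\<delta> m\<close>. Since the terms \<open>r k\<close> are nonnegative, the sum up
    to a fixed \<open>n\<close> may be enlarged to \<open>m \<ge> n\<close>, and the error
    disappears as \<open>m\<close> tends to infinity.\<close>
  have r_sum: "(\<Sum>k<n. r k) \<le> ?C" for n
  proof (rule LIMSEQ_le_const)
    let ?\<delta> = "\<lambda>m. 3 * (real m)\<^sup>2 / (s * real m - l) ^ 3"
    have "(\<lambda>m. 3 * (1 / real m) / (s - l * (1 / real m)) ^ 3) \<longlonglongrightarrow> 3 * 0 / (s - l * 0) ^ 3"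
      by (intro tendsto_intros lim_1_over_n) (use s in simp)
    moreover have "\<forall>\<^sub>F m in sequentially. 3 * (1 / real m) / (s - l * (1 / real m)) ^ 3 = ?\<delta> m"
      using eventually_gt_at_top[of 0]
    proof eventually_elim
      case (elim m)
      then have "s - l * (1 / real m) = (s * real m - l) / real m" by (simp add: field_simps)
      then show ?case using elim by (simp add: power_divide power2_eq_square power3_eq_cube)
    qed
    ultimately have "?\<delta> \<longlonglongrightarrow> 0" by (simp add: tendsto_cong)
    then have "(\<lambda>m. ?C + ?\<delta> m / s) \<longlonglongrightarrow> ?C + 0 / s" by (intro tendsto_intros) (use s in auto)
    then show "(\<lambda>m. ?C + ?\<delta> m / s) \<longlonglongrightarrow> ?C" by simp
    have "(\<Sum>k<n. r k) \<le> ?C + ?\<delta> m / s" if m: "n \<le> m" "nat \<lceil>l / s\<rceil> < m" for m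
    proof -
      have "l / s < real m" using m(2) by linarith
      then have lm: "l < s * real m" using s by (simp add: field_simps)
      have low: "l - ?\<delta> m \<le> s * (\<Sum>k<m. prob_below l x k)"
        using mean_below_lower[OF Vind VD _ l lm] by (simp add: x_def)
      have "(\<Sum>k<n. r k) \<le> (\<Sum>k<m. r k)"
        using m by (intro sum_mono2) (auto simp: r_def)
      also have "\<dots> = 2 * (\<Sum>k<m. p k) + (\<Sum>k<m. q k) - (\<Sum>k<m. prob_below l x k)"
        by (simp add: r_eq sum.distrib sum_subtractf sum_distrib_left)
      also have "\<dots> \<le> 2 * ((s + 1 + \<epsilon> * v * sqrt (2 / pi) / 2 * A) / s) + (l + s + v) / s - (l - ?\<delta> m) / s"
      proof (intro diff_mono add_mono mult_left_mono)
        show "(\<Sum>k<m. p k) \<le> (s + 1 + \<epsilon> * v * sqrt (2 / pi) / 2 * A) / s"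
          using p_sum[of m] s by (simp add: pos_le_divide_eq mult.commute)
        show "(l - ?\<delta> m) / s \<le> (\<Sum>k<m. prob_below l x k)"
          using low s by (simp add: pos_divide_le_eq mult.commute)
      qed (use q_sum[of m] A in auto)
      also have "\<dots> = ?C + ?\<delta> m / s"
        unfolding A_def[symmetric] using s by (simp add: add_divide_distrib diff_divide_distrib ring_distribs)
      finally show ?thesis .
    qed
    then show "\<exists>N. \<forall>m\<ge>N. (\<Sum>k<n. r k) \<le> ?C + ?\<delta> m / s"
      by (intro exI[of _ "max n (Suc (nat \<lceil>l / s\<rceil>))"]) auto
  qed
  \<comment> \<open>If \<open>y\<close> never crossed with positive probability, then
    \<open>n\<close> times that probability would be at most \<open>A\<^sup>2\<close> for all
    \<open>n\<close>, which is impossible. This supplies the finiteness premise of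
    \<open>time_dist_le_suminf\<close>.\<close>
  have fin: "AE \<omega> in M. hitting_time y l \<omega> \<noteq> \<infinity>"
  proof (rule AE_I)
    let ?N = "{\<omega> \<in> space M. \<forall>k. below l (\<lambda>j. y j \<omega>) k}"
    show "{\<omega> \<in> space M. \<not> hitting_time y l \<omega> \<noteq> \<infinity>} \<subseteq> ?N"
    proof
      fix \<omega> assume \<omega>: "\<omega> \<in> {\<omega> \<in> space M. \<not> hitting_time y l \<omega> \<noteq> \<infinity>}"
      have "below l (\<lambda>j. y j \<omega>) k" for k
        using hitting_time_le_iff[of y l \<omega> k] \<omega> by auto
      with \<omega> show "\<omega> \<in> ?N" by auto
    qed
    show "?N \<in> sets M" by measurable
    have "real n * prob ?N \<le> A\<^sup>2" for n
    proof -
      have "real n * prob ?N = (\<Sum>k<n. prob ?N)" by simp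
      also have "\<dots> \<le> (\<Sum>k<n. q k)"
        unfolding q_def by (intro sum_mono finite_measure_mono) auto
      finally show ?thesis using q_sum[of n] by linarith
    qed
    then have "\<not> 0 < prob ?N"
      using ex_less_of_nat_mult[of "prob ?N" "A\<^sup>2"] by (meson leD)
    then show "emeasure M ?N = 0" by (simp add: emeasure_eq_measure zero_less_measure_iff)
  qed
  let ?P = "\<lambda>k \<omega>. below l (\<lambda>j. y j \<omega>) k \<noteq> below l (\<lambda>j. x j \<omega>) k"
  have "(\<integral>\<^sup>+ \<omega>. time_dist (hitting_time y l \<omega>) (hitting_time x l \<omega>) \<partial>M) \<le> (\<integral>\<^sup>+ \<omega>. (\<Sum>k. ennreal (of_bool (?P k \<omega>))) \<partial>M)"
  proof (rule nn_integral_mono_AE, use fin in eventually_elim)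
    fix \<omega> assume "hitting_time y l \<omega> \<noteq> \<infinity>"
    then show "time_dist (hitting_time y l \<omega>) (hitting_time x l \<omega>) \<le> (\<Sum>k. ennreal (of_bool (?P k \<omega>)))"
      using time_dist_le_suminf[of "hitting_time y l \<omega>" "hitting_time x l \<omega>"]
      by (simp only: hitting_time_le_iff simp_thms not_iff)
  qed
  also have "\<dots> = (\<Sum>k. \<integral>\<^sup>+ \<omega>. ennreal (of_bool (?P k \<omega>)) \<partial>M)"
    by (rule nn_integral_suminf) measurable
  also have "\<dots> = (\<Sum>k. ennreal (r k))"
  proof (rule suminf_cong)
    fix k
    have "(\<integral>\<^sup>+ \<omega>. ennreal (of_bool (?P k \<omega>)) \<partial>M) = (\<integral>\<^sup>+ \<omega>. indicator {\<omega> \<in> space M. ?P k \<omega>} \<omega> \<partial>M)"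
      by (rule nn_integral_cong) (simp add: indicator_def)
    also have "\<dots> = ennreal (r k)" by (simp add: r_def emeasure_eq_measure)
    finally show "(\<integral>\<^sup>+ \<omega>. ennreal (of_bool (?P k \<omega>)) \<partial>M) = ennreal (r k)" .
  qed
  also have "\<dots> \<le> ennreal ?C"
  proof (rule suminf_le_const)
    show "(\<Sum>k<n. ennreal (r k)) \<le> ennreal ?C" for n
      using r_sum[of n] by (subst sum_ennreal) (auto simp: r_def intro: ennreal_leI)
  qed simp
  finally show ?thesis by (simp add: est x_def)
qed

end

theorem theorem2p1:
  fixes M :: "'a measure" and V W :: "nat \<Rightarrow> 'a \<Rightarrow> real" and \<epsilon> s l :: real
  assumes "prob_space M"
    and "0 < \<epsilon>" and "0 < s" and "0 < l"
    and "std_gaussian_seq M V" and "std_gaussian_seq M W"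
    and "indep_seqs M V W"
  shows "(\<integral>\<^sup>+ \<omega>. time_dist (hitting_time (est_X s \<epsilon> V W) l \<omega>) (hitting_time (walk_X s V) l \<omega>) \<partial>M)
    \<le> ennreal (
        sqrt (2 * l * \<epsilon>\<^sup>2 / (pi * s ^ 3 * (1 + \<epsilon>\<^sup>2)))
        + sqrt (4 * \<epsilon>\<^sup>2 / (s\<^sup>2 * (1 + \<epsilon>\<^sup>2)))
          * (3 * (l / (2 * pi * s ^ 3)) powr (1 / 4) + 3 * sqrt (3 / s) + sqrt (3 * s) + 6)
        + 4 / (s * sqrt (1 + \<epsilon>\<^sup>2)) + 4 / s + 4)"
  by (rule order_trans[OF prob_space.hitting_times_distance_bound[OF assms] ennreal_leI[OF bound_arith[OF assms(3,4,2)]]])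

end
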